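(* There is a constant $A_{\mathbb{I}}<\infty$ such that for every $n\ge 1$, the spherical maximal operator $M_{\mathcal S}$ on the $n$-dimensional hypercube satisfies $\|M_{\mathcal S}\|_{2\to 2}<A_{\mathbb{I}}$; that is, for all $n$ and all $f:\{0,1\}^n\to\mathbb{R}$, $\|M_{\mathcal S}f\|_2\le A_{\mathbb{I}}\|f\|_2$.
   Context: Let $\mathbb{I}^n=\{0,1\}^n$ with Hamming distance $d(x,y)=|\{i:x_i\ne y_i\}|$, and let $V=\mathbb{R}^{\mathbb{I}^n}$ be the space of real-valued functions on it, with $\|f\|_2=(\sum_x f(x)^2)^{1/2}$. For $0\le k\le n$ the spherical mean $S_k:V\to V$ is $(S_kf)(x)=\binom{n}{k}^{-1}\sum_{y:\,d(x,y)=k}f(y)$. The spherical maximal operator is $(M_{\mathcal S}f)(x)=\max_{0\le k\le n}(S_kf)(x)$. For a (sublinear) operator $M$, $\|M\|_{2\to2}=\sup_{f\ne0}\|Mf\|_2/\|f\|_2$. *)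

theory Defs
  imports Complex_Main
begin

definition cube :: "nat \<Rightarrow> bool list set" where
  "cube n = {xs. length xs = n}"

definition hamming :: "bool list \<Rightarrow> bool list \<Rightarrow> nat" where
  "hamming x y = card {i. i < length x \<and> x ! i \<noteq> y ! i}"

definition sph_mean :: "nat \<Rightarrow> nat \<Rightarrow> (bool list \<Rightarrow> real) \<Rightarrow> bool list \<Rightarrow> real" where
  "sph_mean n k f x = (\<Sum>y\<in>{y\<in>cube n. hamming x y = k}. f y) / real (n choose k)"

definition sph_max :: "nat \<Rightarrow> (bool list \<Rightarrow> real) \<Rightarrow> bool list \<Rightarrow> real" where
  "sph_max n f x = Max ((\<lambda>k. sph_mean n k f x) ` {0..n})"

definition l2norm :: "nat \<Rightarrow> (bool list \<Rightarrow> real) \<Rightarrow> real" where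
  "l2norm n f = sqrt (\<Sum>x\<in>cube n. (f x)\<^sup>2)"

end

(*
  By Walsh-Fourier analysis the spherical mean S_k is diagonal, its eigenvalue on characters of
  weight x being the normalized Krawtchouk polynomial kap_k(x). Take f >= 0.

  Let U_m f(x) be the mean of f after resampling the coordinates of x in a random m-element set. For
  a fixed order in which coordinates get resampled this is a (reverse) martingale, so Doob's
  inequality and averaging over the orders bound sup_m U_m on L^2. As U_m = sum_k C(m,k) 2^-m S_k and
  sum_{m <= 2k} C(m,k) 2^-m = 1, the averages of S_0, ..., S_K are dominated by sup_m U_m. By Abel
  summation, S_{2J} exceeds these averages by at most the square root of
  sum_j (j+1) |S_{2j+2} f - S_{2j} f|^2, and the L^2 norm of this square function is controlled by
  kap_{k+2}(x) - kap_k(x) = O(min(x, n-x)/n) kap^{(n-2)}_k(x-1) together with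
  |kap_k(x)| <= exp(-kx/(4n)) for k, x <= n/2. This covers even k <= n/2. Odd radii reduce to even
  ones since S_{k+1} f <= 2 S_k S_1 f for k <= n/2, and radii above n/2 to the antipode of x.
*)
theory Submission
  imports Defs "HOL-Computational_Algebra.Polynomial" "HOL-Analysis.Convex"
begin

section \<open>Sphere sums on the cube\<close>

text \<open>Unnormalized, and with the dimension read off from \<open>x\<close>, so that identities
  can be proved by induction on the list \<open>x\<close>.\<close>

definition sphere_sum :: "bool list \<Rightarrow> nat \<Rightarrow> (bool list \<Rightarrow> real) \<Rightarrow> real" where
  "sphere_sum x k f = (\<Sum>y\<in>{y\<in>cube (length x). hamming x y = k}. f y)"

lemma cube_0 [simp]: "cube 0 = {[]}"
  by (auto simp: cube_def)

lemma cube_Suc: "cube (Suc n) = Cons False ` cube n \<union> Cons True ` cube n"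
  by (auto simp: cube_def length_Suc_conv image_iff)

lemma finite_cube [simp]: "finite (cube n)"
  by (induction n) (auto simp: cube_Suc)

text \<open>The free bit \<open>b\<close> lets the half containing a given point be listed
  first.\<close>

lemma sum_cube_Suc:
  fixes f :: "bool list \<Rightarrow> real"
  shows "(\<Sum>x\<in>cube (Suc n). f x) = (\<Sum>x\<in>cube n. f (b # x)) + (\<Sum>x\<in>cube n. f ((\<not> b) # x))"
proof -
  have "(\<Sum>x\<in>cube (Suc n). f x) = (\<Sum>x\<in>Cons False ` cube n. f x) + (\<Sum>x\<in>Cons True ` cube n. f x)"
    unfolding cube_Suc by (rule sum.union_disjoint) auto
  then show ?thesis by (cases b) (simp_all add: sum.reindex)
qed

lemma hamming_Nil [simp]: "hamming [] y = 0"
  by (simp add: hamming_def)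

lemma hamming_Cons [simp]: "hamming (b # x) (c # y) = (if b = c then 0 else 1) + hamming x y"
proof -
  have "{i. i < length (b # x) \<and> (b # x) ! i \<noteq> (c # y) ! i} =
        (if b = c then {} else {0}) \<union> Suc ` {i. i < length x \<and> x ! i \<noteq> y ! i}"
    (is "?L = ?R")
  proof (rule set_eqI)
    fix i show "i \<in> ?L \<longleftrightarrow> i \<in> ?R" by (cases i) auto
  qed
  moreover have "card ((if b = c then {} else {0::nat}) \<union> Suc ` {i. i < length x \<and> x ! i \<noteq> y ! i})
     = card (if b = c then {} else {0::nat}) + card (Suc ` {i. i < length x \<and> x ! i \<noteq> y ! i})"
    by (rule card_Un_disjoint) auto
  ultimately show ?thesis by (simp add: hamming_def card_image)
qed

lemma sphere_sum_if:
  "sphere_sum x k f = (\<Sum>y\<in>cube (length x). if hamming x y = k then f y else 0)"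
  by (simp add: sphere_sum_def sum.inter_filter)

lemma sphere_sum_Nil [simp]: "sphere_sum [] k f = (if k = 0 then f [] else 0)"
  by (simp add: sphere_sum_if)

lemma sphere_sum_Cons_0: "sphere_sum (b # x) 0 f = sphere_sum x 0 (\<lambda>z. f (b # z))"
  by (simp add: sphere_sum_if sum_cube_Suc[where b=b])

lemma sphere_sum_0 [simp]: "sphere_sum x 0 f = f x"
  by (induction x arbitrary: f) (simp_all add: sphere_sum_Cons_0)

text \<open>The first bit either agrees, leaving all \<open>Suc k\<close> differences to the tail,
  or differs and uses up one of them. Later inductions on \<open>x\<close> rest on this
  recursion.\<close>

lemma sphere_sum_Cons_Suc:
  "sphere_sum (b # x) (Suc k) f =
     sphere_sum x (Suc k) (\<lambda>z. f (b # z)) + sphere_sum x k (\<lambda>z. f ((\<not> b) # z))"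
  by (simp add: sphere_sum_if sum_cube_Suc[where b=b])

lemma sphere_sum_cong:
  "(\<And>y. y \<in> cube (length x) \<Longrightarrow> f y = g y) \<Longrightarrow> sphere_sum x k f = sphere_sum x k g"
  unfolding sphere_sum_def by (rule sum.cong) auto

lemma sphere_sum_nonneg: "(\<And>y. 0 \<le> f y) \<Longrightarrow> 0 \<le> sphere_sum x k f"
  by (simp add: sphere_sum_def sum_nonneg)

lemma sphere_sum_add: "sphere_sum x k (\<lambda>y. f y + g y) = sphere_sum x k f + sphere_sum x k g"
  by (simp add: sphere_sum_def sum.distrib)

lemma sphere_sum_divide: "sphere_sum x k (\<lambda>y. f y / c) = sphere_sum x k f / c"
  by (simp add: sphere_sum_def sum_divide_distrib)

lemma sphere_sum_gt_length: "length x < k \<Longrightarrow> sphere_sum x k f = 0"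
proof (induction x arbitrary: k f)
  case (Cons b x)
  then show ?case by (cases k) (auto simp: sphere_sum_Cons_Suc)
qed simp

lemma sum_sphere_sum: "(\<Sum>k\<le>length x. sphere_sum x k f) = (\<Sum>y\<in>cube (length x). f y)"
proof (induction x arbitrary: f)
  case (Cons b x)
  have "(\<Sum>k\<le>length (b # x). sphere_sum (b # x) k f)
      = f (b # x) + (\<Sum>k\<le>length x. sphere_sum x (Suc k) (\<lambda>z. f (b # z)))
        + (\<Sum>k\<le>length x. sphere_sum x k (\<lambda>z. f ((\<not> b) # z)))"
    by (simp add: sum.atMost_Suc_shift sphere_sum_Cons_Suc sum.distrib del: sum.atMost_Suc)
  also have "f (b # x) + (\<Sum>k\<le>length x. sphere_sum x (Suc k) (\<lambda>z. f (b # z)))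
      = (\<Sum>k\<le>Suc (length x). sphere_sum x k (\<lambda>z. f (b # z)))"
    by (simp add: sum.atMost_Suc_shift del: sum.atMost_Suc)
  also have "\<dots> = (\<Sum>k\<le>length x. sphere_sum x k (\<lambda>z. f (b # z)))"
    by (simp add: sphere_sum_gt_length)
  finally show ?case
    by (simp add: Cons.IH sum_cube_Suc[where b=b])
qed simp

text \<open>Each point at distance \<open>k + 1\<close> from \<open>x\<close> has \<open>k + 1\<close> neighbours at distance \<open>k\<close> from \<open>x\<close>.\<close>

lemma sphere_sum_Suc_le:
  assumes "\<And>y. 0 \<le> f y"
  shows "real (Suc k) * sphere_sum x (Suc k) f \<le> sphere_sum x k (\<lambda>y. sphere_sum y 1 f)"
  using assms
proof (induction x arbitrary: k f)
  case (Cons b x)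
  let ?g = "\<lambda>z. f (b # z)" and ?h = "\<lambda>z. f ((\<not> b) # z)"
  have IH: "real (Suc j) * sphere_sum x (Suc j) ?g \<le> sphere_sum x j (\<lambda>y. sphere_sum y 1 ?g)"
     "real (Suc j) * sphere_sum x (Suc j) ?h \<le> sphere_sum x j (\<lambda>y. sphere_sum y 1 ?h)" for j
    by (rule Cons.IH, rule Cons.prems)+
  have 1: "sphere_sum (c # y) 1 f = sphere_sum y 1 (\<lambda>z. f (c # z)) + f ((\<not> c) # y)" for c y
    by (simp add: sphere_sum_Cons_Suc)
  \<comment> \<open>Walks that flip the first bit and flip it back end at distance \<open>j\<close>
    instead of \<open>k + 1\<close>; their contribution is nonnegative and gets dropped.\<close>
  have nn: "0 \<le> sphere_sum x j ?g" for j
    by (intro sphere_sum_nonneg Cons.prems)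
  show ?case
  proof (cases k)
    case 0
    then show ?thesis by simp
  next
    case (Suc j)
    have "sphere_sum (b # x) k (\<lambda>y. sphere_sum y 1 f)
       = sphere_sum x k (\<lambda>y. sphere_sum y 1 ?g) + sphere_sum x k ?h
       + (sphere_sum x j (\<lambda>y. sphere_sum y 1 ?h) + sphere_sum x j ?g)"
      by (simp only: Suc sphere_sum_Cons_Suc 1 sphere_sum_add not_not)
    moreover have "real (Suc k) * sphere_sum (b # x) (Suc k) f
       = real (Suc k) * sphere_sum x (Suc k) ?g + real (Suc j) * sphere_sum x k ?h + sphere_sum x k ?h"
      by (simp add: sphere_sum_Cons_Suc Suc algebra_simps)
    ultimately show ?thesis
      using IH(1)[of k] IH(2)[of j] nn[of j] Suc by simp
  qed
qed simp

section \<open>Antipodal points\<close>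

lemma hamming_map_Not:
  "length x = length y \<Longrightarrow> hamming x y + hamming (map Not x) y = length x"
  by (induction x y rule: list_induct2) auto

lemma sphere_sum_map_Not:
  assumes "k \<le> length x"
  shows "sphere_sum (map Not x) k f = sphere_sum x (length x - k) f"
proof -
  have "hamming (map Not x) y = k \<longleftrightarrow> hamming x y = length x - k" if "y \<in> cube (length x)" for y
    using hamming_map_Not[of x y] that assms by (auto simp: cube_def)
  then show ?thesis unfolding sphere_sum_if by (intro sum.cong) auto
qed

lemma sum_cube_map_Not:
  fixes f :: "bool list \<Rightarrow> real"
  shows "(\<Sum>x\<in>cube n. f (map Not x)) = (\<Sum>x\<in>cube n. f x)"
  by (rule sum.reindex_bij_witness[where i="map Not" and j="map Not"])
     (auto simp: cube_def comp_def)

section \<open>Fourier transform\<close>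

text \<open>The character \<open>x\<close> \<mapsto> (-1)^(s . x), where \<open>s\<close> encodes a
  set of coordinates and s . x counts the common \<open>True\<close> entries.\<close>

fun walsh :: "bool list \<Rightarrow> bool list \<Rightarrow> real" where
  "walsh (c # s) (b # x) = (if c \<and> b then - 1 else 1) * walsh s x"
| "walsh _ _ = 1"

definition fourier :: "(bool list \<Rightarrow> real) \<Rightarrow> bool list \<Rightarrow> real" where
  "fourier f s = (\<Sum>x\<in>cube (length s). walsh s x * f x)"

lemma fourier_Nil [simp]: "fourier f [] = f []"
  by (simp add: fourier_def)

lemma fourier_Cons:
  "fourier f (c # s) =
     fourier (\<lambda>x. f (False # x)) s + (if c then - 1 else 1) * fourier (\<lambda>x. f (True # x)) s"
  by (simp add: fourier_def sum_cube_Suc[where b=False] sum_negf)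

lemma fourier_add: "fourier (\<lambda>x. f x + g x) s = fourier f s + fourier g s"
  by (simp add: fourier_def algebra_simps sum.distrib)

lemma fourier_cmult: "fourier (\<lambda>x. c * f x) s = c * fourier f s"
  by (simp add: fourier_def sum_distrib_left mult_ac)

text \<open>Each coordinate contributes the parallelogram law (p + q)^2 + (p - q)^2 = 2 p^2 + 2 q^2,
  and with it a factor 2, since \<open>fourier\<close> is not normalized.\<close>

lemma parseval: "(\<Sum>s\<in>cube n. (fourier f s)\<^sup>2) = 2 ^ n * (\<Sum>x\<in>cube n. (f x)\<^sup>2)"
proof (induction n arbitrary: f)
  case (Suc n)
  let ?g = "fourier (\<lambda>x. f (False # x))" and ?h = "fourier (\<lambda>x. f (True # x))"
  have "(\<Sum>s\<in>cube (Suc n). (fourier f s)\<^sup>2)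
      = (\<Sum>s\<in>cube n. (?g s + ?h s)\<^sup>2 + (?g s - ?h s)\<^sup>2)"
    by (simp add: sum_cube_Suc[where b=False] fourier_Cons sum.distrib)
  also have "\<dots> = (\<Sum>s\<in>cube n. 2 * (?g s)\<^sup>2 + 2 * (?h s)\<^sup>2)"
    by (intro sum.cong refl) (simp add: power2_eq_square algebra_simps)
  also have "\<dots> = 2 * (\<Sum>s\<in>cube n. (?g s)\<^sup>2) + 2 * (\<Sum>s\<in>cube n. (?h s)\<^sup>2)"
    by (simp add: sum.distrib sum_distrib_left)
  finally show ?case
    by (simp add: Suc.IH sum_cube_Suc[where b=False] algebra_simps)
qed simp

section \<open>Krawtchouk polynomials\<close>

text \<open>The usual \<open>K\<^sub>k(x)\<close> in dimension \<open>n = x + y\<close>.\<close>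

definition kraw :: "nat \<Rightarrow> nat \<Rightarrow> nat \<Rightarrow> real" where
  "kraw x y k = coeff ([:1, - 1:] ^ x * [:1, 1:] ^ y) k"

abbreviation weight :: "bool list \<Rightarrow> nat" where
  "weight s \<equiv> count_list s True"

abbreviation coweight :: "bool list \<Rightarrow> nat" where
  "coweight s \<equiv> count_list s False"

lemma weight_add_coweight: "weight s + coweight s = length s"
  by (induction s) auto

lemma coeff_linear_mult_Suc:
  "coeff ([:a, b:] * p) (Suc k) = a * coeff p (Suc k) + (b::real) * coeff p k"
  by simp

lemma kraw_0 [simp]: "kraw x y 0 = 1"
  by (simp add: kraw_def coeff_mult_0 coeff_0_power)

text \<open>One more factor 1 - z in the generating polynomial; \<open>kraw_Suc2\<close> is the same
  for 1 + z.\<close>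

lemma kraw_Suc1: "kraw (Suc x) y (Suc k) = kraw x y (Suc k) - kraw x y k"
  unfolding kraw_def power_Suc mult.assoc coeff_linear_mult_Suc by simp

lemma kraw_Suc2: "kraw x (Suc y) (Suc k) = kraw x y (Suc k) + kraw x y k"
  unfolding kraw_def power_Suc mult.left_commute[of "[:1, - 1:] ^ x"] coeff_linear_mult_Suc by simp

lemma kraw_0_0 [simp]: "kraw 0 0 (Suc k) = 0"
  by (simp add: kraw_def)

text \<open>Characters are eigenvectors of the sphere sums: splitting off one coordinate of
  \<open>s\<close> by \<open>sphere_sum_Cons_Suc\<close> produces exactly the recursions
  \<open>kraw_Suc1\<close> (bit \<open>True\<close>) and \<open>kraw_Suc2\<close> (bit
  \<open>False\<close>).\<close>

lemma fourier_sphere_sum: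
  "fourier (\<lambda>x. sphere_sum x k f) s = kraw (weight s) (coweight s) k * fourier f s"
proof (induction s arbitrary: k f)
  case Nil
  then show ?case by (cases k) auto
next
  case (Cons c s)
  show ?case
  proof (cases k)
    case 0
    then show ?thesis by simp
  next
    case (Suc j)
    then show ?thesis
      by (cases c)
         (simp_all add: fourier_Cons sphere_sum_Cons_Suc fourier_add Cons.IH kraw_Suc1 kraw_Suc2
           algebra_simps)
  qed
qed

lemma kraw_0_left: "kraw 0 y k = real (y choose k)"
proof (induction y arbitrary: k)
  case 0
  then show ?case by (cases k) auto
next
  case (Suc y)
  then show ?case by (cases k) (auto simp: kraw_Suc2)
qed

text \<open>Replacing z by -z exchanges the two factors of the generating polynomial.\<close>

lemma kraw_swap: "kraw y x k = (- 1) ^ k * kraw x y k"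
proof (induction x arbitrary: k)
  case 0
  show ?case
  proof (induction y arbitrary: k)
    case 0
    then show ?case by (cases k) auto
  next
    case (Suc y)
    then show ?case by (cases k) (auto simp: kraw_Suc1 kraw_Suc2 algebra_simps)
  qed
next
  case (Suc x)
  then show ?case by (cases k) (auto simp: kraw_Suc1 kraw_Suc2 algebra_simps)
qed

text \<open>The coefficients of (1 - z)^x (1 + z)^y are dominated by those of (1 + z)^(x +
  y).\<close>

lemma abs_kraw_le: "\<bar>kraw x y k\<bar> \<le> real (x + y choose k)"
proof (induction x arbitrary: k)
  case 0
  then show ?case by (simp add: kraw_0_left)
next
  case (Suc x)
  show ?case
  proof (cases k)
    case (Suc j)
    then show ?thesis using Suc.IH[of k] Suc.IH[of j] by (simp add: kraw_Suc1)
  qed simp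
qed

text \<open>Both sides are the coefficient of z^k in the derivative of (1 - z)^x (1 + z)^y.
  Truncated subtraction is harmless, as the coefficient in front is then 0.\<close>

lemma kraw_pderiv:
  "real (Suc k) * kraw x y (Suc k) =
     real y * kraw x (y - 1) k - real x * kraw (x - 1) y k"
proof (induction x arbitrary: k)
  case 0
  show ?case
  proof (cases y)
    case (Suc z)
    have "real (Suc z) * real (z choose k) = real (Suc k) * real (Suc z choose Suc k)"
      by (metis Suc_times_binomial_eq of_nat_mult mult.commute)
    then show ?thesis by (simp add: kraw_0_left Suc)
  qed simp
next
  case (Suc x)
  show ?case
  proof (cases k)
    case 0
    then show ?thesis using Suc.IH[of 0] by (simp add: kraw_Suc1)
  next
    case (Suc j)
    have x: "real x * kraw x y (Suc j) = real x * (kraw (x - 1) y (Suc j) - kraw (x - 1) y j)"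
      by (cases x) (auto simp: kraw_Suc1)
    show ?thesis
      using Suc.IH[of k] Suc.IH[of j] x Suc by (simp add: kraw_Suc1 algebra_simps)
  qed
qed

text \<open>This is the derivative of \<open>(1 - z\<^sup>2)\<^sup>x (1 + z)\<^sup>m\<close>.\<close>

lemma kraw_rec:
  "real (k + 2) * kraw x (x + m) (k + 2) =
     real m * kraw x (x + m - 1) (k + 1) - 2 * real x * kraw (x - 1) (x + m - 1) k"
proof (cases x)
  case 0
  then show ?thesis using kraw_pderiv[of "Suc k" 0 m] by simp
next
  case (Suc w)
  have "kraw w (Suc (w + m)) (Suc k) = kraw w (w + m) (Suc k) + kraw w (w + m) k"
       "kraw (Suc w) (w + m) (Suc k) = kraw w (w + m) (Suc k) - kraw w (w + m) k"
    by (simp_all add: kraw_Suc1 kraw_Suc2)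
  moreover have "real (k + 2) * kraw x (x + m) (k + 2)
      = real (x + m) * kraw (Suc w) (w + m) (Suc k) - real x * kraw w (Suc (w + m)) (Suc k)"
    using kraw_pderiv[of "Suc k" x "x + m"] Suc by simp
  ultimately have "real (k + 2) * kraw x (x + m) (k + 2)
      = real m * kraw (Suc w) (w + m) (Suc k) - 2 * real x * kraw w (w + m) k"
    by (simp only: of_nat_add) (simp add: algebra_simps)
  then show ?thesis using Suc by simp
qed

text \<open>\<open>A\<close> is multiplication of the generating polynomial by 1 - z^2. Together
  with the derivative it gives \<open>B\<close>, a three-term recurrence in the radius for
  \<open>kraw x y\<close>; its instances at k, k + 1 and k + 2 eliminate the indices of the other
  parity, and the difference of squares d^2 - (n + 2)^2 produces the right side.\<close>

lemma kraw_diff: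
  fixes x y k :: nat
  defines "n \<equiv> real x + real y"
  shows "(real k + 4) * (real k + 3) * kraw (Suc x) (Suc y) (k + 4)
     - (n - real k) * (n - real k - 1) * kraw (Suc x) (Suc y) (k + 2)
     = - 4 * (real x + 1) * (real y + 1) * kraw x y (k + 2)"
proof -
  have A: "kraw (Suc x) (Suc y) (j + 2) = kraw x y (j + 2) - kraw x y j" for j
    by (simp add: kraw_Suc1 kraw_Suc2)
  have B: "(real j + 2) * (kraw x y (j + 2) - kraw x y j)
         = (real y - real x) * kraw x y (j + 1) - (n + 2) * kraw x y j" for j
    using kraw_pderiv[of "j + 1" "Suc x" "Suc y"] A[of j]
    by (simp add: kraw_Suc1 kraw_Suc2 algebra_simps n_def)
  define d where "d = real y - real x"
  define m where "m j = kraw x y (k + j)" for j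
  have B0: "(real k + 2) * (m 2 - m 0) = d * m 1 - (n + 2) * m 0"
    using B[of k] by (simp add: m_def d_def)
  have B1: "(real k + 3) * (m 3 - m 1) = d * m 2 - (n + 2) * m 1"
    using B[of "k + 1"] by (simp add: m_def d_def numeral_eq_Suc add.commute)
  have B2: "(real k + 4) * (m 4 - m 2) = d * m 3 - (n + 2) * m 2"
    using B[of "k + 2"] by (simp add: m_def d_def numeral_eq_Suc add.commute)
  have C0: "d * m 1 = (real k + 2) * m 2 + (n - real k) * m 0"
    using B0 by (simp add: algebra_simps)
  have C1: "(real k + 3) * m 3 = d * m 2 - (n - real k - 1) * m 1"
    using B1 by (simp add: algebra_simps)
  have "(real k + 4) * (real k + 3) * (m 4 - m 2) = (real k + 3) * (d * m 3 - (n + 2) * m 2)"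
    using B2 by simp
  also have "\<dots> = d * ((real k + 3) * m 3) - (real k + 3) * (n + 2) * m 2"
    by (simp add: algebra_simps)
  also have "\<dots> = d * d * m 2 - (n - real k - 1) * (d * m 1) - (real k + 3) * (n + 2) * m 2"
    unfolding C1 by (simp add: algebra_simps)
  also have "\<dots> = (d * d - (n + 2) * (n + 2)) * m 2 + (n - real k) * (n - real k - 1) * (m 2 - m 0)"
    unfolding C0 by (simp add: algebra_simps)
  also have "d * d - (n + 2) * (n + 2) = - 4 * (real x + 1) * (real y + 1)"
    by (simp add: d_def n_def algebra_simps)
  finally show ?thesis
    using A[of k] A[of "k + 2"] by (simp add: m_def numeral_eq_Suc)
qed

lemma kraw_1: "kraw x y (Suc 0) = real y - real x"
  using kraw_pderiv[of 0 x y] by simp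

text \<open>This is \<open>kraw_diff\<close> shifted down by two; the only even index it does not
  reach is 0, which is computed directly.\<close>

lemma kraw_diff_even:
  fixes x y k :: nat
  defines "n \<equiv> real x + real y"
  assumes "even k"
  shows "(real k + 2) * (real k + 1) * kraw (Suc x) (Suc y) (k + 2)
     - (n + 2 - real k) * (n + 1 - real k) * kraw (Suc x) (Suc y) k
     = - (4 * (real x + 1) * (real y + 1) * kraw x y k)"
proof (cases "k = 0")
  case True
  show ?thesis
    using kraw_pderiv[of "Suc 0" "Suc x" "Suc y"] kraw_1[of "Suc x" y] kraw_1[of x "Suc y"]
    by (simp add: True n_def algebra_simps numeral_eq_Suc)
next
  case False
  then have "2 \<le> k" using assms(2) by (auto intro: dvd_imp_le)
  then obtain j where "k = j + 2" by (metis le_add_diff_inverse2)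
  then show ?thesis using kraw_diff[of j x y] by (simp add: n_def algebra_simps numeral_eq_Suc)
qed

section \<open>Normalized Krawtchouk polynomials and their differences\<close>

definition kap :: "nat \<Rightarrow> nat \<Rightarrow> nat \<Rightarrow> real" where
  "kap x y k = kraw x y k / real (x + y choose k)"

lemma kap_0 [simp]: "kap x y 0 = 1"
  by (simp add: kap_def)

lemma kap_0_left: "k \<le> y \<Longrightarrow> kap 0 y k = 1"
  by (simp add: kap_def kraw_0_left)

lemma kap_swap: "kap y x k = (- 1) ^ k * kap x y k"
  by (simp add: kap_def kraw_swap[of y x] add.commute)

lemma abs_kap_le_1: "\<bar>kap x y k\<bar> \<le> 1"
  using abs_kraw_le[of x y k] by (auto simp: kap_def divide_le_eq_1)

lemma choose_real_Suc:
  "(real k + 1) * real (Suc n choose Suc k) = (real n + 1) * real (n choose k)"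
  by (metis Suc_times_binomial_eq add.commute mult.commute of_nat_Suc of_nat_mult)

lemma choose_real_up:
  "k \<le> n \<Longrightarrow> (real k + 1) * real (n choose Suc k) = (real n - real k) * real (n choose k)"
proof (induction n arbitrary: k)
  case (Suc n)
  show ?case
  proof (cases k)
    case 0
    then show ?thesis by simp
  next
    case (Suc j)
    have "(real j + 1) * real (Suc n choose Suc j) = (real n + 1) * real (n choose j)"
      by (rule choose_real_Suc)
    moreover have "(real j + 1) * real (n choose Suc j) = (real n - real j) * real (n choose j)"
      using Suc.IH[of j] Suc.prems Suc by simp
    moreover have "(real k + 1) * real (Suc n choose Suc k) = (real n + 1) * real (n choose k)"
      by (rule choose_real_Suc)
    ultimately show ?thesis using Suc
      by (simp add: algebra_simps)
  qed
qed simp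

text \<open>The two weights in \<open>kraw_diff_even\<close>, multiplied by the binomial
  coefficients of dimension n + 2 at k + 2 and at k, both give \<open>?T\<close>, that is (n + 2) (n
  + 1) times n choose k. Division by \<open>?T\<close> therefore normalizes all three terms at
  once.\<close>

lemma kap_diff:
  assumes "even k" "k \<le> x + y"
  shows "kap (Suc x) (Suc y) (k + 2) - kap (Suc x) (Suc y) k =
     - (4 * (real x + 1) * (real y + 1) / ((real (x + y) + 2) * (real (x + y) + 1))) * kap x y k"
proof -
  define n where "n = real x + real y"
  define c where "c = real (x + y choose k)"
  have c: "c > 0" using assms by (simp add: c_def)
  have nk: "real k \<le> n" using assms by (simp add: n_def flip: of_nat_add)
  have n0: "0 \<le> n" by (simp add: n_def)
  let ?T = "(n + 2) * (n + 1) * c"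
  have 1: "(real k + 2) * (real k + 1) * real (Suc (Suc (x + y)) choose Suc (Suc k)) = ?T"
  proof -
    have p1: "(real k + 2) * real (Suc (Suc (x + y)) choose Suc (Suc k)) = (n + 2) * real (Suc (x + y) choose Suc k)"
      using choose_real_Suc[of "Suc k" "Suc (x + y)"]
      by (simp add: n_def add.commute add.left_commute del: binomial_Suc_Suc)
    have p2: "(real k + 1) * real (Suc (x + y) choose Suc k) = (n + 1) * c"
      using choose_real_Suc[of k "x + y"] by (simp add: n_def c_def del: binomial_Suc_Suc)
    have "(real k + 2) * (real k + 1) * real (Suc (Suc (x + y)) choose Suc (Suc k))
        = (real k + 1) * ((real k + 2) * real (Suc (Suc (x + y)) choose Suc (Suc k)))"
      by (simp only: mult_ac)
    also have "\<dots> = (n + 2) * ((real k + 1) * real (Suc (x + y) choose Suc k))"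
      unfolding p1 by (simp only: mult_ac)
    also have "\<dots> = ?T" unfolding p2 by (simp only: mult_ac)
    finally show ?thesis .
  qed
  have u: "(real k + 1) * real (Suc (Suc (x + y)) choose Suc k) = (n + 2 - real k) * real (Suc (Suc (x + y)) choose k)"
       "(real k + 2) * real (Suc (Suc (x + y)) choose Suc (Suc k)) = (n + 1 - real k) * real (Suc (Suc (x + y)) choose Suc k)"
    using choose_real_up[of k "Suc (Suc (x + y))"] choose_real_up[of "Suc k" "Suc (Suc (x + y))"] assms
    by (simp_all add: n_def add.commute add.left_commute del: binomial_Suc_Suc)
  have 2: "(n + 2 - real k) * (n + 1 - real k) * real (Suc (Suc (x + y)) choose k) = ?T"
  proof -
    have "(n + 2 - real k) * (n + 1 - real k) * real (Suc (Suc (x + y)) choose k)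
       = (n + 1 - real k) * ((n + 2 - real k) * real (Suc (Suc (x + y)) choose k))"
      by (simp only: mult_ac)
    also have "\<dots> = (real k + 1) * ((n + 1 - real k) * real (Suc (Suc (x + y)) choose Suc k))"
      unfolding u(1)[symmetric] by (simp only: mult_ac)
    also have "\<dots> = ?T" unfolding u(2)[symmetric] 1[symmetric] by (simp only: mult_ac)
    finally show ?thesis .
  qed
  have T: "?T > 0" using c n0 by simp
  have "kap (Suc x) (Suc y) (k + 2) = (real k + 2) * (real k + 1) * kraw (Suc x) (Suc y) (k + 2) / ?T"
    unfolding 1[symmetric] kap_def using assms by simp
  moreover have "kap (Suc x) (Suc y) k = (n + 2 - real k) * (n + 1 - real k) * kraw (Suc x) (Suc y) k / ?T"
    unfolding 2[symmetric] kap_def using nk by simp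
  ultimately have "kap (Suc x) (Suc y) (k + 2) - kap (Suc x) (Suc y) k
      = - (4 * (real x + 1) * (real y + 1) * kraw x y k) / ?T"
    using kraw_diff_even[OF assms(1), of x y] by (simp add: n_def diff_divide_distrib[symmetric])
  then show ?thesis
    by (simp only: kap_def n_def c_def of_nat_add mult_minus_left times_divide_times_eq
        minus_divide_left[symmetric])
qed

text \<open>Closes the induction in \<open>abs_kap_le_exp\<close>, where a = x/n. By e^t \<le> 1 + t
  + t^2 the left side is at most (1 - 2a)(1 + a/2) + 3a/2 = 1 - a^2.\<close>

lemma exp_quarter_bound:
  fixes a :: real
  assumes "0 \<le> a" "a \<le> 1/2"
  shows "(1 - 2 * a) * exp (a / 4) + a * exp (1 / 4) \<le> 1"
proof -
  have "exp (a / 4) \<le> 1 + a / 4 + (a / 4)\<^sup>2" using assms by (intro exp_bound) auto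
  also have "(a / 4)\<^sup>2 \<le> a / 4 * 1" unfolding power2_eq_square
    using assms by (intro mult_left_mono) auto
  finally have "(1 - 2 * a) * exp (a / 4) \<le> (1 - 2 * a) * (1 + a / 2)"
    using assms by (intro mult_left_mono) auto
  moreover have "exp (1 / 4) \<le> 1 + 1/4 + (1 / 4 :: real)\<^sup>2" by (intro exp_bound) auto
  then have "a * exp (1 / 4) \<le> a * (3/2)"
    using assms by (intro mult_left_mono) (auto simp: power2_eq_square)
  moreover have "(1 - 2 * a) * (1 + a / 2) + a * (3/2) = 1 - a * a" by (simp add: field_simps)
  ultimately show ?thesis by (smt (verit) zero_le_square)
qed

text \<open>\<open>kraw_rec\<close> divided by the binomial coefficient. The weights m/n and 2x/n
  add up to 1, and the second term carries the extra factor (k + 1)/(n - 1), which is at most 1/2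
  once k + 2 \<le> n/2; this factor is the source of the exponential decay.\<close>

lemma kap_rec:
  assumes "k + 2 \<le> 2 * x + m"
  defines "n \<equiv> real (2 * x + m)"
  shows "kap x (x + m) (k + 2) = (real m / n) * kap x (x + m - 1) (k + 1)
     - (2 * real x / n) * ((real k + 1) / (n - 1)) * kap (x - 1) (x + m - 1) k"
proof -
  define N where "N = 2 * x + m - 2"
  have N: "2 * x + m = Suc (Suc N)" using assms by (simp add: N_def)
  have n: "n = real N + 2" using N by (simp add: n_def)
  define c where "c = real (N choose k)"
  have c: "c > 0" using assms N by (simp add: c_def)
  have 1: "(real k + 1) * real (Suc N choose Suc k) = (n - 1) * c"
    using choose_real_Suc[of k N] by (simp add: n c_def)
  have 2: "(real k + 2) * real (Suc (Suc N) choose Suc (Suc k)) = n * real (Suc N choose Suc k)"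
    using choose_real_Suc[of "Suc k" "Suc N"] by (simp add: n add.commute)
  have c1: "real (Suc N choose Suc k) > 0" using assms N by (simp del: binomial_Suc_Suc)
  have n1: "n > 1" by (simp add: n)
  have "kap x (x + m) (k + 2) = kraw x (x + m) (k + 2) / real (Suc (Suc N) choose Suc (Suc k))"
  proof -
    have "x + (x + m) = Suc (Suc N)" using N by linarith
    then show ?thesis unfolding kap_def by (simp del: binomial_Suc_Suc)
  qed
  also have "\<dots> = real (k + 2) * kraw x (x + m) (k + 2) / (n * real (Suc N choose Suc k))"
    unfolding 2[symmetric] by (simp add: add.commute del: binomial_Suc_Suc)
  also have "\<dots> = real m * kraw x (x + m - 1) (k + 1) / (n * real (Suc N choose Suc k))
     - 2 * real x * kraw (x - 1) (x + m - 1) k / (n * real (Suc N choose Suc k))"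
    unfolding kraw_rec by (simp add: diff_divide_distrib)
  also have "real m * kraw x (x + m - 1) (k + 1) / (n * real (Suc N choose Suc k))
     = (real m / n) * kap x (x + m - 1) (k + 1)"
  proof (cases "m = 0")
    case False
    then have "x + (x + m - 1) = Suc N" using N by linarith
    then show ?thesis by (simp add: kap_def del: binomial_Suc_Suc)
  qed simp
  also have "2 * real x * kraw (x - 1) (x + m - 1) k / (n * real (Suc N choose Suc k))
     = (2 * real x / n) * ((real k + 1) / (n - 1)) * kap (x - 1) (x + m - 1) k"
  proof (cases "x = 0")
    case False
    then have "x - 1 + (x + m - 1) = N" using N by linarith
    then have e1: "kap (x - 1) (x + m - 1) k = kraw (x - 1) (x + m - 1) k / c"
      by (simp add: kap_def c_def)
    have e2: "real (Suc N choose Suc k) = (n - 1) * c / (real k + 1)"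
      using 1 by (simp add: field_simps del: binomial_Suc_Suc)
    show ?thesis unfolding e1 e2 by (simp add: mult_ac)
  qed simp
  finally show ?thesis .
qed

text \<open>Induction through \<open>kap_rec\<close>. Lowering radius and dimension by 1 weakens the
  claimed bound \<open>E\<close> by at most exp (a/4) with a = x/n, and lowering radius and
  dimension by 2 and x by 1 weakens it by at most exp (1/4); \<open>exp_quarter_bound\<close>
  absorbs both losses.\<close>

lemma abs_kap_le_exp:
  assumes "x \<le> y" "2 * k \<le> x + y"
  shows "\<bar>kap x y k\<bar> \<le> exp (- (real k * real x / (4 * real (x + y))))"
  using assms
proof (induction k arbitrary: x y rule: less_induct)
  case (less k)
  consider "k = 0" | "k = 1" | j where "k = j + 2"
    by (metis One_nat_def add_2_eq_Suc' not0_implies_Suc)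
  then show ?case
  proof cases
    case 1
    then show ?thesis by simp
  next
    case 2
    define n where "n = real (x + y)"
    have n: "n \<ge> 2" using less.prems 2 by (simp add: n_def)
    have "kap x y k = 1 - 2 * (real x / n)"
      using n by (simp add: 2 kap_def kraw_1 n_def field_simps)
    moreover have "2 * (real x / n) \<le> 1" using less.prems n by (simp add: n_def field_simps)
    ultimately have "\<bar>kap x y k\<bar> = 1 - 2 * (real x / n)" by simp
    also have "\<dots> \<le> 1 + - (real x / (4 * n))" using n by (simp add: field_simps)
    also have "\<dots> \<le> exp (- (real x / (4 * n)))" by (rule exp_ge_add_one_self)
    finally show ?thesis using 2 by (simp add: n_def)
  next
    case 3
    define m where "m = y - x"
    have y: "y = x + m" using less.prems by (simp add: m_def)
    define n where "n = real (2 * x + m)"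
    have xn: "2 * real x \<le> n" and mn: "real m = n - 2 * real x" by (simp_all add: n_def)
    have kn: "2 * real k \<le> n"
    proof -
      have "2 * k \<le> 2 * x + m" using less.prems by (simp add: y)
      then have "real (2 * k) \<le> real (2 * x + m)" by (simp only: of_nat_le_iff)
      then show ?thesis by (simp add: n_def)
    qed
    have k2: "real k \<ge> 2" using 3 by simp
    have n4: "n \<ge> 4" using kn k2 by simp
    define E where "E = exp (- (real k * real x / (4 * n)))"
    have E: "E > 0" by (simp add: E_def)
    define a where "a = real x / n"
    have a: "0 \<le> a" "a \<le> 1/2" using n4 xn by (simp_all add: a_def field_simps)
    \<comment> \<open>For m = 0 the pair (x, x + m - 1) leaves the range x \<le> y, but its
      coefficient in \<open>kap_rec\<close> is then 0.\<close>
    have b1: "\<bar>kap x (x + m - 1) (j + 1)\<bar> \<le> E * exp (a / 4)" if "m > 0"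
    proof -
      have r: "real (x + (x + m - 1)) = n - 1" using that by (simp add: n_def)
      have "\<bar>kap x (x + m - 1) (j + 1)\<bar> \<le> exp (- ((real k - 1) * real x / (4 * (n - 1))))"
        using less.IH[of "j + 1" x "x + m - 1"] that less.prems unfolding r
        by (simp add: 3 y)
      also have "(real k - 1) * real x / (4 * n) \<le> (real k - 1) * real x / (4 * (n - 1))"
        using n4 k2 by (intro divide_left_mono) auto
      then have "exp (- ((real k - 1) * real x / (4 * (n - 1)))) \<le> exp (- ((real k - 1) * real x / (4 * n)))"
        by simp
      also have "- ((real k - 1) * real x / (4 * n)) = - (real k * real x / (4 * n)) + a / 4"
        using n4 by (simp add: a_def field_simps)
      also have "exp \<dots> = E * exp (a / 4)" unfolding E_def exp_add ..
      finally show ?thesis .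
    qed
    have b2: "\<bar>kap (x - 1) (x + m - 1) j\<bar> \<le> E * exp (1 / 4)" if "x > 0"
    proof -
      have r: "real (x - 1 + (x + m - 1)) = n - 2" using that by (simp add: n_def)
      have x1: "real (x - 1) = real x - 1" using that by simp
      have "\<bar>kap (x - 1) (x + m - 1) j\<bar> \<le> exp (- ((real k - 2) * (real x - 1) / (4 * (n - 2))))"
        using less.IH[of j "x - 1" "x + m - 1"] that less.prems unfolding r x1
        by (simp add: 3 y)
      \<comment> \<open>Before the division by 4 the exponent loses at most 1. After clearing
        denominators this uses both k \<le> n/2 and x \<le> n/2.\<close>
      also have "real k * real x / n - 1 \<le> (real k - 2) * (real x - 1) / (n - 2)"
      proof -
        have "real k * real x * (n - 2) - n * (real k - 2) * (real x - 1) =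
              real k * (n - 2 * real x) + 2 * n * (real x - 1)"
          by (simp add: algebra_simps)
        also have "real k * (n - 2 * real x) \<le> n / 2 * (n - 2 * real x)"
          using kn xn by (intro mult_right_mono) auto
        also have "n / 2 * (n - 2 * real x) + 2 * n * (real x - 1) = n * (n / 2 + real x - 2)"
          by (simp add: field_simps)
        also have "\<dots> \<le> n * (n - 2)" using n4 xn by (intro mult_left_mono) auto
        finally show ?thesis using n4 by (simp add: field_simps)
      qed
      then have "exp (- ((real k - 2) * (real x - 1) / (4 * (n - 2)))) \<le> exp (- (real k * real x / (4 * n)) + 1 / 4)"
      proof -
        have quarter: "p / (4 * q) = 1 / 4 * (p / q)" for p q :: real by simp
        have "- (1 / 4 * q) \<le> - (1 / 4 * p) + 1 / 4" if "p - 1 \<le> q" for p q :: real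
          using that by simp
        then show ?thesis if "real k * real x / n - 1 \<le> (real k - 2) * (real x - 1) / (n - 2)"
          unfolding exp_le_cancel_iff quarter using that by blast
      qed
      also have "\<dots> = E * exp (1 / 4)" unfolding E_def exp_add ..
      finally show ?thesis .
    qed
    have t0: "\<bar>kap x y k\<bar> \<le> \<bar>(real m / n) * kap x (x + m - 1) (j + 1)\<bar>
     + \<bar>(2 * real x / n) * ((real j + 1) / (n - 1)) * kap (x - 1) (x + m - 1) j\<bar>"
    proof -
      have "j + 2 \<le> 2 * x + m" using less.prems y 3 by linarith
      then show ?thesis unfolding y 3 n_def kap_rec[OF \<open>j + 2 \<le> 2 * x + m\<close>]
        by (intro abs_triangle_ineq4)
    qed
    have t1: "\<bar>(real m / n) * kap x (x + m - 1) (j + 1)\<bar> \<le> (1 - 2 * a) * (E * exp (a / 4))"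
    proof (cases "m = 0")
      case True
      then show ?thesis using E a by simp
    next
      case False
      have "real m / n = 1 - 2 * a" using n4 by (simp add: mn a_def field_simps)
      then show ?thesis using b1 False a by (simp add: abs_mult mult_left_mono)
    qed
    have t2: "\<bar>(2 * real x / n) * ((real j + 1) / (n - 1)) * kap (x - 1) (x + m - 1) j\<bar>
        \<le> a * (E * exp (1 / 4))"
    proof (cases "x = 0")
      case True
      then show ?thesis using E a by simp
    next
      case False
      have "(real j + 1) / (n - 1) \<le> 1 / 2" using 3 kn n4 by (simp add: field_simps)
      then have "(2 * real x / n) * ((real j + 1) / (n - 1)) \<le> (2 * real x / n) * (1 / 2)"
        using n4 by (intro mult_left_mono) auto
      also have "\<dots> = a" by (simp add: a_def)
      finally have "(2 * real x / n) * ((real j + 1) / (n - 1)) \<le> a" .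
      moreover have "0 \<le> (2 * real x / n) * ((real j + 1) / (n - 1))" using n4 by simp
      ultimately have "\<bar>(2 * real x / n) * ((real j + 1) / (n - 1))\<bar> \<le> a"
        by (simp only: abs_of_nonneg)
      moreover have "\<bar>kap (x - 1) (x + m - 1) j\<bar> \<le> E * exp (1 / 4)"
        using b2 False by simp
      ultimately show ?thesis unfolding abs_mult[of _ "kap (x - 1) (x + m - 1) j"]
        using a(1) abs_ge_zero by (rule mult_mono)
    qed
    have "(1 - 2 * a) * (E * exp (a / 4)) + a * (E * exp (1 / 4))
        = E * ((1 - 2 * a) * exp (a / 4) + a * exp (1 / 4))"
      by (simp add: algebra_simps)
    also have "\<dots> \<le> E * 1" using E a by (intro mult_left_mono exp_quarter_bound) auto
    finally have "\<bar>kap x y k\<bar> \<le> E" using t0 t1 t2 by linarith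
    moreover have "n = real (x + y)" by (simp add: n_def y)
    ultimately show ?thesis by (simp only: E_def)
  qed
qed

section \<open>The multiplier of the square function\<close>

lemma sum_arith_geometric_le:
  fixes r :: real
  assumes "0 \<le> r" "r < 1"
  shows "(\<Sum>j<J. (real j + 1) * r ^ j) \<le> 1 / (1 - r)\<^sup>2"
proof -
  have "(1 - r)\<^sup>2 * (\<Sum>j<J. (real j + 1) * r ^ j) = 1 - (real J + 1) * r ^ J + real J * r ^ Suc J"
    by (induction J) (simp_all add: algebra_simps power2_eq_square)
  also have "\<dots> \<le> 1"
  proof -
    have "r * (real J * r ^ J) \<le> 1 * (real J * r ^ J)"
      using assms by (intro mult_right_mono) auto
    moreover have "0 \<le> r ^ J" using assms by simp
    ultimately show ?thesis by (simp add: algebra_simps)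
  qed
  finally show ?thesis using assms by (simp add: field_simps)
qed

text \<open>With x = u + 1, y = v + 1 and N = u + v, \<open>kap_diff\<close> and
  \<open>abs_kap_le_exp\<close> bound the j-th squared difference by (4 (u + 1)/(N + 1))^2 exp
  (-u/N)^j. The weighted sum of the exponentials is of order (N/u)^2, which cancels the prefactor.
  For x = 0 all differences vanish.\<close>

lemma sum_kap_diff_le_aux:
  assumes "x \<le> y" "4 * J \<le> x + y"
  shows "(\<Sum>j<J. (real j + 1) * (kap x y (2 * j + 2) - kap x y (2 * j))\<^sup>2) \<le> 256"
proof (cases x)
  case 0
  then have "kap x y (2 * j + 2) - kap x y (2 * j) = 0" if "j < J" for j
    using that assms by (simp add: kap_0_left)
  then show ?thesis by simp
next
  case (Suc u)
  then obtain v where y: "y = Suc v" using assms by (cases y) auto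
  have uv: "u \<le> v" using assms Suc y by simp
  define N where "N = real (u + v)"
  have N0: "N \<ge> 0" "real u \<le> N" by (simp_all add: N_def)
  have term_le: "(kap x y (2 * j + 2) - kap x y (2 * j))\<^sup>2 \<le>
      (4 * (real u + 1) / (N + 1))\<^sup>2 * exp (- (real u / N)) ^ j" if "j < J" for j
  proof -
    let ?B = "4 * (real u + 1) * (real v + 1) / ((N + 2) * (N + 1))"
    have j: "4 * j \<le> u + v" using that assms Suc y by simp
    have "4 * (real u + 1) * (real v + 1) / ((N + 2) * (N + 1))
        = (4 * (real u + 1) / (N + 1)) * ((real v + 1) / (N + 2))" by simp
    also have "\<dots> \<le> (4 * (real u + 1) / (N + 1)) * 1"
      by (intro mult_left_mono) (auto simp: N_def)
    finally have B: "?B \<le> 4 * (real u + 1) / (N + 1)" by simp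
    have "kap x y (2 * j + 2) - kap x y (2 * j) = - ?B * kap u v (2 * j)"
      using kap_diff[of "2 * j" u v] j by (simp add: Suc y N_def)
    then have "(kap x y (2 * j + 2) - kap x y (2 * j))\<^sup>2 = ?B\<^sup>2 * (kap u v (2 * j))\<^sup>2"
      by (simp only: power_mult_distrib power2_minus)
    also have "\<dots> \<le> (4 * (real u + 1) / (N + 1))\<^sup>2 * exp (- (real u / N)) ^ j"
    proof (intro mult_mono)
      show "?B\<^sup>2 \<le> (4 * (real u + 1) / (N + 1))\<^sup>2"
        using B N0 by (intro power_mono) auto
      have "\<bar>kap u v (2 * j)\<bar> \<le> exp (- (real (2 * j) * real u / (4 * N)))"
        using abs_kap_le_exp[OF uv, of "2 * j"] j by (simp add: N_def)
      then have "\<bar>kap u v (2 * j)\<bar>\<^sup>2 \<le> (exp (- (real (2 * j) * real u / (4 * N))))\<^sup>2"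
        by (intro power_mono) auto
      also have "\<dots> = exp (- (real u / N)) ^ j"
        by (simp add: exp_of_nat_mult[symmetric])
      finally show "(kap u v (2 * j))\<^sup>2 \<le> exp (- (real u / N)) ^ j" by simp
    qed auto
    finally show ?thesis .
  qed
  have "(\<Sum>j<J. (real j + 1) * (kap x y (2 * j + 2) - kap x y (2 * j))\<^sup>2)
     \<le> (\<Sum>j<J. (real j + 1) * ((4 * (real u + 1) / (N + 1))\<^sup>2 * exp (- (real u / N)) ^ j))"
    by (intro sum_mono mult_left_mono term_le) auto
  also have "\<dots> = (4 * (real u + 1) / (N + 1))\<^sup>2 * (\<Sum>j<J. (real j + 1) * exp (- (real u / N)) ^ j)"
    by (simp only: sum_distrib_left mult.left_commute)
  also have "\<dots> \<le> 256"
  proof (cases "u = 0")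
    case True
    \<comment> \<open>Without decay the weighted sum is at most J^2, and J \<le> N + 1 makes up for
      this against the prefactor 4/(N + 1).\<close>
    have J: "real J \<le> N + 1" using assms Suc y by (simp add: N_def)
    have "(\<Sum>j<J. (real j + 1)) \<le> (\<Sum>j<J. real J)" by (intro sum_mono) auto
    also have "\<dots> = real J * real J" by simp
    also have "\<dots> \<le> (N + 1) * (N + 1)" using J N0 by (intro mult_mono) auto
    finally have "(4 / (N + 1))\<^sup>2 * (\<Sum>j<J. (real j + 1)) \<le> (4 / (N + 1))\<^sup>2 * ((N + 1) * (N + 1))"
      by (intro mult_left_mono) auto
    also have "\<dots> = 16" using N0 by (simp add: power2_eq_square)
    finally show ?thesis using True by simp
  next
    case False
    then have N: "N > 0" by (simp add: N_def)
    define t where "t = real u / N"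
    have t: "0 < t" "t \<le> 1" using N False N0 by (simp_all add: t_def)
    have "exp (- t) \<le> 1 / (1 + t)"
      using t exp_ge_add_one_self[of t] by (simp add: exp_minus field_simps)
    also have "\<dots> \<le> 1 - t / 2"
    proof -
      have "t * t \<le> 1 * t" using t by (intro mult_right_mono) auto
      then show ?thesis using t by (simp add: field_simps)
    qed
    finally have r: "t / 2 \<le> 1 - exp (- t)" by simp
    have "(\<Sum>j<J. (real j + 1) * exp (- t) ^ j) \<le> 1 / (1 - exp (- t))\<^sup>2"
      using t by (intro sum_arith_geometric_le) auto
    also have "\<dots> \<le> 1 / (t / 2)\<^sup>2"
      using r t by (intro divide_left_mono power_mono) auto
    finally have "(4 * (real u + 1) / (N + 1))\<^sup>2 * (\<Sum>j<J. (real j + 1) * exp (- t) ^ j)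
       \<le> (4 * (real u + 1) / (N + 1))\<^sup>2 * (1 / (t / 2)\<^sup>2)"
      by (intro mult_left_mono) auto
    also have "\<dots> = (4 * (real u + 1) / (N + 1) * (2 / t))\<^sup>2"
    proof -
      have "1 / (t / 2)\<^sup>2 = (2 / t)\<^sup>2" by (simp add: power_divide)
      then show ?thesis by (simp only: power_mult_distrib)
    qed
    \<comment> \<open>The base equals 8 ((u + 1)/u) (N/(N + 1)) \<le> 8 * 2, whence 256 =
      16^2.\<close>
    also have "\<dots> \<le> 16\<^sup>2"
    proof (intro power_mono)
      have "4 * (real u + 1) / (N + 1) * (2 / t) = 8 * ((real u + 1) / real u) * (N / (N + 1))"
        using N False by (simp add: t_def field_simps)
      also have "\<dots> \<le> 8 * 2 * 1"
        using N False by (intro mult_mono) (auto simp: field_simps)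
      finally show "4 * (real u + 1) / (N + 1) * (2 / t) \<le> 16" by simp
      show "0 \<le> 4 * (real u + 1) / (N + 1) * (2 / t)" using t N by simp
    qed
    finally show ?thesis by (simp add: t_def)
  qed
  finally show ?thesis .
qed

text \<open>At even radii \<open>kap\<close> is symmetric in its first two arguments by
  \<open>kap_swap\<close>, so x \<le> y may be assumed.\<close>

lemma sum_kap_diff_le:
  assumes "4 * J \<le> x + y"
  shows "(\<Sum>j<J. (real j + 1) * (kap x y (2 * j + 2) - kap x y (2 * j))\<^sup>2) \<le> 256"
proof (cases "x \<le> y")
  case True
  then show ?thesis using assms by (rule sum_kap_diff_le_aux)
next
  case False
  have "kap x y (2 * j) = kap y x (2 * j)" "kap x y (2 * j + 2) = kap y x (2 * j + 2)" for j
    using kap_swap[of x y "2 * j"] kap_swap[of x y "2 * j + 2"] by simp_all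
  then have "(\<Sum>j<J. (real j + 1) * (kap x y (2 * j + 2) - kap x y (2 * j))\<^sup>2) =
      (\<Sum>j<J. (real j + 1) * (kap y x (2 * j + 2) - kap y x (2 * j))\<^sup>2)"
    by (intro sum.cong) (simp_all only:)
  then show ?thesis
    using sum_kap_diff_le_aux[of y x J] assms False by simp
qed

section \<open>The maximal inequality for random resampling\<close>

definition delete_at :: "nat \<Rightarrow> 'a list \<Rightarrow> 'a list" where
  "delete_at i x = take i x @ drop (Suc i) x"

definition insert_at :: "nat \<Rightarrow> 'a \<Rightarrow> 'a list \<Rightarrow> 'a list" where
  "insert_at i b x = take i x @ b # drop i x"

lemma delete_at_0 [simp]: "delete_at 0 (b # x) = x"
  and delete_at_Suc [simp]: "delete_at (Suc i) (b # x) = b # delete_at i x"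
  by (simp_all add: delete_at_def)

lemma insert_at_0 [simp]: "insert_at 0 b x = b # x"
  and insert_at_Suc [simp]: "insert_at (Suc i) b (c # x) = c # insert_at i b x"
  by (simp_all add: insert_at_def)

lemma length_delete_at: "i < length x \<Longrightarrow> length (delete_at i x) = length x - 1"
  by (simp add: delete_at_def)

lemma insert_at_delete_at: "i < length x \<Longrightarrow> insert_at i (x ! i) (delete_at i x) = x"
  by (simp add: insert_at_def delete_at_def min_def flip: id_take_nth_drop)

text \<open>Mapping \<open>x\<close> to the pair of \<open>x ! i\<close> and
  \<open>delete_at i x\<close> is a bijection onto pairs of a bit and a point of dimension
  n.\<close>

lemma sum_cube_delete_at:
  fixes \<phi> :: "bool \<Rightarrow> bool list \<Rightarrow> real"
  assumes "i \<le> n"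
  shows "(\<Sum>x\<in>cube (Suc n). \<phi> (x ! i) (delete_at i x)) = (\<Sum>b\<in>UNIV. \<Sum>w\<in>cube n. \<phi> b w)"
  using assms
proof (induction n arbitrary: i \<phi>)
  case 0
  then show ?case by (simp add: sum_cube_Suc[where b=False] UNIV_bool)
next
  case (Suc n)
  show ?case
  proof (cases i)
    case 0
    then show ?thesis by (simp add: sum_cube_Suc[where b=False and n="Suc n"] UNIV_bool)
  next
    case i: (Suc j)
    have "(\<Sum>x\<in>cube (Suc (Suc n)). \<phi> (x ! i) (delete_at i x))
      = (\<Sum>b\<in>UNIV. \<Sum>w\<in>cube n. \<phi> b (False # w)) + (\<Sum>b\<in>UNIV. \<Sum>w\<in>cube n. \<phi> b (True # w))"
      using Suc.IH[of j "\<lambda>b w. \<phi> b (False # w)"] Suc.IH[of j "\<lambda>b w. \<phi> b (True # w)"] Suc.prems i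
      by (simp add: sum_cube_Suc[where b=False and n="Suc n"])
    also have "\<dots> = (\<Sum>b\<in>UNIV. \<Sum>w\<in>cube (Suc n). \<phi> b w)"
      by (simp add: sum_cube_Suc[where b=False] sum.distrib)
    finally show ?thesis .
  qed
qed

lemma sum_cube_insert_at:
  fixes f :: "bool list \<Rightarrow> real"
  assumes "i \<le> n"
  shows "(\<Sum>b\<in>UNIV. \<Sum>w\<in>cube n. f (insert_at i b w)) = (\<Sum>x\<in>cube (Suc n). f x)"
  unfolding sum_cube_delete_at[OF assms, symmetric]
  using assms by (intro sum.cong) (auto simp: cube_def insert_at_delete_at)

text \<open>Double counting: a point at distance k from \<open>x\<close> is counted once for each of
  the coordinates in which it agrees with \<open>x\<close>, and there are \<open>length x\<close> -
  k of these.\<close>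

lemma sum_sphere_sum_delete_at:
  "(\<Sum>i<length x. sphere_sum (delete_at i x) k (\<lambda>z. f (insert_at i (x ! i) z)))
     = (real (length x) - real k) * sphere_sum x k f"
proof (induction x arbitrary: k f)
  case (Cons b x)
  show ?case
  proof (cases k)
    case 0
    then show ?thesis
      by (simp add: insert_at_delete_at sum.lessThan_Suc_shift algebra_simps del: sum.lessThan_Suc)
  next
    case (Suc j)
    have "(\<Sum>i<length (b # x). sphere_sum (delete_at i (b # x)) k (\<lambda>z. f (insert_at i ((b # x) ! i) z)))
       = sphere_sum x k (\<lambda>z. f (b # z))
       + (\<Sum>i<length x. sphere_sum (delete_at i x) k (\<lambda>z. f (b # insert_at i (x ! i) z)))
       + (\<Sum>i<length x. sphere_sum (delete_at i x) j (\<lambda>z. f ((\<not> b) # insert_at i (x ! i) z)))"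
      by (simp add: Suc sum.lessThan_Suc_shift sphere_sum_Cons_Suc sum.distrib del: sum.lessThan_Suc)
    also have "\<dots> = sphere_sum x k (\<lambda>z. f (b # z))
       + (real (length x) - real k) * sphere_sum x k (\<lambda>z. f (b # z))
       + (real (length x) - real j) * sphere_sum x j (\<lambda>z. f ((\<not> b) # z))"
      using Cons.IH[of k "\<lambda>z. f (b # z)"] Cons.IH[of j "\<lambda>z. f ((\<not> b) # z)"] by simp
    finally show ?thesis by (simp add: Suc sphere_sum_Cons_Suc algebra_simps)
  qed
qed simp

text \<open>The mean of \<open>f\<close> after resampling uniformly the coordinates of \<open>x\<close> in a uniformly random set
  of \<open>m\<close> coordinates.\<close>

definition resample_mean :: "nat \<Rightarrow> bool list \<Rightarrow> (bool list \<Rightarrow> real) \<Rightarrow> real" where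
  "resample_mean m x f =
     (\<Sum>k\<le>m. real (m choose k) / 2 ^ m * (sphere_sum x k f / real (length x choose k)))"

lemma resample_mean_length:
  "resample_mean (length x) x f = (\<Sum>y\<in>cube (length x). f y) / 2 ^ length x"
proof -
  have "resample_mean (length x) x f = (\<Sum>k\<le>length x. sphere_sum x k f / 2 ^ length x)"
    unfolding resample_mean_def by (intro sum.cong) auto
  then show ?thesis by (simp add: sum_sphere_sum flip: sum_divide_distrib)
qed

text \<open>As m \<le> n, some coordinate is not resampled. Given a uniformly random such coordinate
  \<open>i\<close>, the resampled set is a uniform m-subset of the other n, so the same mean appears
  in dimension n for \<open>f\<close> with coordinate \<open>i\<close> frozen. For each distance k
  this is \<open>sum_sphere_sum_delete_at\<close>.\<close>

lemma resample_mean_delete_at: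
  assumes "length x = Suc n" "m \<le> n"
  shows "resample_mean m x f =
    (\<Sum>i\<le>n. resample_mean m (delete_at i x) (\<lambda>z. f (insert_at i (x ! i) z))) / (real n + 1)"
proof -
  let ?g = "\<lambda>i z. f (insert_at i (x ! i) z)"
  have "(\<Sum>i\<le>n. resample_mean m (delete_at i x) (?g i))
      = (\<Sum>i\<le>n. \<Sum>k\<le>m. real (m choose k) / 2 ^ m * (sphere_sum (delete_at i x) k (?g i) / real (n choose k)))"
    unfolding resample_mean_def using assms
    by (intro sum.cong refl) (simp add: length_delete_at)
  also have "\<dots> = (\<Sum>k\<le>m. \<Sum>i\<le>n. real (m choose k) / 2 ^ m * (sphere_sum (delete_at i x) k (?g i) / real (n choose k)))"
    by (rule sum.swap)
  also have "\<dots> = (\<Sum>k\<le>m. real (m choose k) / 2 ^ m * ((\<Sum>i\<le>n. sphere_sum (delete_at i x) k (?g i)) / real (n choose k)))"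
    by (simp add: sum_distrib_left sum_divide_distrib)
  also have "\<dots> = (\<Sum>k\<le>m. (real n + 1) * (real (m choose k) / 2 ^ m * (sphere_sum x k f / real (Suc n choose k))))"
  proof (intro sum.cong refl)
    fix k assume "k \<in> {..m}"
    then have k: "k \<le> n" using assms by simp
    have "(\<Sum>i\<le>n. sphere_sum (delete_at i x) k (?g i)) = (real n + 1 - real k) * sphere_sum x k f"
      using sum_sphere_sum_delete_at[of x k f] assms
      by (simp add: lessThan_Suc_atMost add.commute)
    moreover have "(real n + 1 - real k) * real (Suc n choose k) = (real n + 1) * real (n choose k)"
      using choose_real_Suc[of k n] choose_real_up[of k "Suc n"] k
      by (simp add: algebra_simps del: binomial_Suc_Suc)
    then have "(real n + 1 - real k) / real (n choose k) = (real n + 1) / real (Suc n choose k)"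
      using k by (simp add: frac_eq_eq)
    ultimately have "(\<Sum>i\<le>n. sphere_sum (delete_at i x) k (?g i)) / real (n choose k)
        = (real n + 1) / real (Suc n choose k) * sphere_sum x k f"
      by (metis times_divide_eq_left)
    then show "real (m choose k) / 2 ^ m * ((\<Sum>i\<le>n. sphere_sum (delete_at i x) k (?g i)) / real (n choose k))
       = (real n + 1) * (real (m choose k) / 2 ^ m * (sphere_sum x k f / real (Suc n choose k)))"
      by simp
  qed
  also have "\<dots> = (real n + 1) * resample_mean m x f"
    using assms by (simp add: resample_mean_def sum_distrib_left del: binomial_Suc_Suc)
  finally show ?thesis by (simp add: add_nonneg_eq_0_iff)
qed

section \<open>Doob's inequality for the resampling maximal function\<close>

definition resample_max :: "nat \<Rightarrow> bool list \<Rightarrow> (bool list \<Rightarrow> real) \<Rightarrow> real" where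
  "resample_max n x f = Max ((\<lambda>m. resample_mean m x f) ` {..n})"

lemma resample_mean_le_max: "m \<le> n \<Longrightarrow> resample_mean m x f \<le> resample_max n x f"
  by (simp add: resample_max_def)

lemma resample_max_le: "(\<And>m. m \<le> n \<Longrightarrow> resample_mean m x f \<le> b) \<Longrightarrow> resample_max n x f \<le> b"
  by (simp add: resample_max_def)

lemma power2_mean_le:
  fixes a :: "nat \<Rightarrow> real"
  shows "((\<Sum>i\<le>n. a i) / (real n + 1))\<^sup>2 \<le> (\<Sum>i\<le>n. (a i)\<^sup>2) / (real n + 1)"
proof -
  have "(\<Sum>i\<le>n. a i)\<^sup>2 \<le> (\<Sum>i\<le>n. (a i)\<^sup>2) * (real n + 1)"
    using sum_squared_le_sum_of_squares[of a "{..n}"] by (simp add: add.commute)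
  then have "(\<Sum>i\<le>n. a i)\<^sup>2 / (real n + 1)\<^sup>2 \<le> (\<Sum>i\<le>n. (a i)\<^sup>2) * (real n + 1) / (real n + 1)\<^sup>2"
    by (rule divide_right_mono) simp
  then show ?thesis by (simp add: power_divide power2_eq_square[of "real n + 1"] add_nonneg_eq_0_iff)
qed

text \<open>Doob's \<open>L\<^sup>2\<close> inequality for the martingale revealing the coordinates one at a time, in the
  form of an induction hypothesis: \<open>c\<close> is the running maximum so far.\<close>

lemma sum_max_resample_max_le:
  assumes "0 \<le> c" "(\<Sum>x\<in>cube n. f x) \<le> c * 2 ^ n"
  shows "(\<Sum>x\<in>cube n. (max c (resample_max n x f))\<^sup>2)
     \<le> 4 * (\<Sum>x\<in>cube n. (f x)\<^sup>2) - 4 * c * (\<Sum>x\<in>cube n. f x) + 2 * c\<^sup>2 * 2 ^ n"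
  using assms
proof (induction n arbitrary: c f)
  case 0
  \<comment> \<open>In dimension 0 the assumption reads \<open>f [] \<le> c\<close>, and the claim
    reduces to the square below.\<close>
  have "max c (f []) = c" using 0 by simp
  moreover have "0 \<le> (2 * f [] - c)\<^sup>2" by simp
  ultimately show ?case
    by (simp add: resample_max_def resample_mean_def power2_eq_square algebra_simps)
next
  case (Suc n)
  define g where "g i b = (\<lambda>z. f (insert_at i b z))" for i b
  define h where "h i b w = (max c (resample_max n w (g i b)))\<^sup>2" for i b w
  \<comment> \<open>For m = n + 1 the mean is the global one, already at most \<open>c\<close>. For
    m \<le> n, freezing an untouched coordinate bounds the maximum by an average over
    \<open>i\<close> of maxima in dimension n, and squaring is convex.\<close>
  have point: "(max c (resample_max (Suc n) x f))\<^sup>2 \<le>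
      (\<Sum>i\<le>n. h i (x ! i) (delete_at i x)) / (real n + 1)" if x: "x \<in> cube (Suc n)" for x
  proof -
    have len: "length x = Suc n" using x by (simp add: cube_def)
    let ?a = "\<lambda>i. max c (resample_max n (delete_at i x) (g i (x ! i)))"
    let ?R = "(\<Sum>i\<le>n. ?a i) / (real n + 1)"
    have "c = (\<Sum>i\<le>n. c) / (real n + 1)" by (simp add: field_simps)
    also have "\<dots> \<le> ?R" by (intro divide_right_mono sum_mono) auto
    finally have c: "c \<le> ?R" .
    have "resample_mean m x f \<le> ?R" if "m \<le> Suc n" for m
    proof (cases "m = Suc n")
      case True
      have "resample_mean m x f = (\<Sum>x\<in>cube (Suc n). f x) / 2 ^ Suc n"
        using resample_mean_length[of x f] unfolding len True .
      also have "\<dots> \<le> c" using Suc.prems by (simp add: divide_le_eq)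
      finally show ?thesis using c by simp
    next
      case False
      then have "m \<le> n" using that by simp
      then have "resample_mean m x f = (\<Sum>i\<le>n. resample_mean m (delete_at i x) (g i (x ! i))) / (real n + 1)"
        using resample_mean_delete_at[OF len] by (simp add: g_def)
      also have "\<dots> \<le> ?R"
        using \<open>m \<le> n\<close> by (intro divide_right_mono sum_mono) (auto intro: resample_mean_le_max max.coboundedI2)
      finally show ?thesis .
    qed
    then have "max c (resample_max (Suc n) x f) \<le> ?R" using c by (simp add: resample_max_le)
    then have "(max c (resample_max (Suc n) x f))\<^sup>2 \<le> ?R\<^sup>2"
      using Suc.prems by (intro power_mono) auto
    also have "\<dots> \<le> (\<Sum>i\<le>n. (?a i)\<^sup>2) / (real n + 1)" by (rule power2_mean_le)
    finally show ?thesis by (simp add: h_def)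
  qed
  have bound: "(\<Sum>b\<in>UNIV. \<Sum>w\<in>cube n. h i b w)
      \<le> 4 * (\<Sum>x\<in>cube (Suc n). (f x)\<^sup>2) - 4 * c * (\<Sum>x\<in>cube (Suc n). f x) + 2 * c\<^sup>2 * 2 ^ Suc n"
    if i: "i \<le> n" for i
  proof -
    have half: "(\<Sum>w\<in>cube n. h i b w)
        \<le> 4 * (\<Sum>w\<in>cube n. (g i b w)\<^sup>2) - 4 * c * (\<Sum>w\<in>cube n. g i b w) + 2 * c\<^sup>2 * 2 ^ n" for b
    proof -
      define s where "s = (\<Sum>w\<in>cube n. g i b w) / 2 ^ n"
      have s: "(\<Sum>w\<in>cube n. g i b w) = s * 2 ^ n" by (simp add: s_def)
      \<comment> \<open>The mean \<open>s\<close> over the half where coordinate \<open>i\<close>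
        equals \<open>b\<close> joins the running maximum, so the induction hypothesis applies with
        \<open>?d\<close>.\<close>
      let ?d = "max c s"
      have "(\<Sum>w\<in>cube n. h i b w) \<le> (\<Sum>w\<in>cube n. (max ?d (resample_max n w (g i b)))\<^sup>2)"
        unfolding h_def using Suc.prems by (intro sum_mono power_mono) auto
      also have "\<dots> \<le> 4 * (\<Sum>w\<in>cube n. (g i b w)\<^sup>2) - 4 * ?d * (\<Sum>w\<in>cube n. g i b w) + 2 * ?d\<^sup>2 * 2 ^ n"
        using Suc.prems by (intro Suc.IH) (auto simp: s)
      also have "\<dots> = 4 * (\<Sum>w\<in>cube n. (g i b w)\<^sup>2) + (2 * ?d\<^sup>2 - 4 * ?d * s) * 2 ^ n"
        unfolding s by (simp add: algebra_simps)
      \<comment> \<open>As a function of d, 2 d^2 - 4 d s is smallest at d = s, so raising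
        \<open>c\<close> to \<open>s\<close> only lowers it.\<close>
      also have "2 * ?d\<^sup>2 - 4 * ?d * s \<le> 2 * c\<^sup>2 - 4 * c * s"
      proof (cases "c \<le> s")
        case True
        have "0 \<le> 2 * (s - c)\<^sup>2" by simp
        then show ?thesis using True by (simp add: max_def power2_eq_square algebra_simps)
      qed (simp add: max_def)
      then have "4 * (\<Sum>w\<in>cube n. (g i b w)\<^sup>2) + (2 * ?d\<^sup>2 - 4 * ?d * s) * 2 ^ n
         \<le> 4 * (\<Sum>w\<in>cube n. (g i b w)\<^sup>2) + (2 * c\<^sup>2 - 4 * c * s) * 2 ^ n"
        by (intro add_left_mono mult_right_mono) auto
      also have "\<dots> = 4 * (\<Sum>w\<in>cube n. (g i b w)\<^sup>2) - 4 * c * (\<Sum>w\<in>cube n. g i b w) + 2 * c\<^sup>2 * 2 ^ n"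
        unfolding s by (simp add: algebra_simps)
      finally show ?thesis .
    qed
    have "(\<Sum>b\<in>UNIV. \<Sum>w\<in>cube n. h i b w)
        \<le> (\<Sum>b\<in>UNIV. 4 * (\<Sum>w\<in>cube n. (g i b w)\<^sup>2) - 4 * c * (\<Sum>w\<in>cube n. g i b w) + 2 * c\<^sup>2 * 2 ^ n)"
      by (intro sum_mono half)
    also have "\<dots> = 4 * (\<Sum>b\<in>UNIV. \<Sum>w\<in>cube n. (g i b w)\<^sup>2) - 4 * c * (\<Sum>b\<in>UNIV. \<Sum>w\<in>cube n. g i b w)
        + 2 * c\<^sup>2 * 2 ^ Suc n"
      by (simp add: UNIV_bool algebra_simps)
    finally show ?thesis
      unfolding g_def sum_cube_insert_at[OF i, of f] sum_cube_insert_at[OF i, of "\<lambda>x. (f x)\<^sup>2"] .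
  qed
  let ?B = "4 * (\<Sum>x\<in>cube (Suc n). (f x)\<^sup>2) - 4 * c * (\<Sum>x\<in>cube (Suc n). f x) + 2 * c\<^sup>2 * 2 ^ Suc n"
  have "(\<Sum>x\<in>cube (Suc n). (max c (resample_max (Suc n) x f))\<^sup>2)
      \<le> (\<Sum>x\<in>cube (Suc n). (\<Sum>i\<le>n. h i (x ! i) (delete_at i x)) / (real n + 1))"
    by (intro sum_mono point)
  also have "\<dots> = (\<Sum>i\<le>n. \<Sum>x\<in>cube (Suc n). h i (x ! i) (delete_at i x)) / (real n + 1)"
    by (simp only: sum.swap[of _ "{..n}"] sum_divide_distrib[symmetric])
  also have "\<dots> = (\<Sum>i\<le>n. \<Sum>b\<in>UNIV. \<Sum>w\<in>cube n. h i b w) / (real n + 1)"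
    by (intro arg_cong2[where f="(/)"] sum.cong sum_cube_delete_at refl) simp
  also have "\<dots> \<le> (\<Sum>i\<le>n. ?B) / (real n + 1)"
    by (intro divide_right_mono sum_mono bound) auto
  also have "\<dots> = (real n + 1) * ?B / (real n + 1)" by (simp only: sum_constant card_atMost of_nat_Suc add.commute)
  also have "\<dots> = ?B" by (rule nonzero_mult_div_cancel_left) simp
  finally show ?case .
qed

text \<open>The martingale starts from the global mean \<open>c\<close>, for which the assumption of
  \<open>sum_max_resample_max_le\<close> is an equality and the terms involving \<open>c\<close> add
  up to -2 c^2 2^n \<le> 0.\<close>

lemma sum_resample_max_le:
  assumes "\<And>x. 0 \<le> f x"
  shows "(\<Sum>x\<in>cube n. (resample_max n x f)\<^sup>2) \<le> 4 * (\<Sum>x\<in>cube n. (f x)\<^sup>2)"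
proof -
  define c where "c = (\<Sum>x\<in>cube n. f x) / 2 ^ n"
  have c: "(\<Sum>x\<in>cube n. f x) = c * 2 ^ n" "0 \<le> c" using assms by (simp_all add: c_def sum_nonneg)
  have "(\<Sum>x\<in>cube n. (resample_max n x f)\<^sup>2) \<le> (\<Sum>x\<in>cube n. (max c (resample_max n x f))\<^sup>2)"
  proof (intro sum_mono power_mono)
    fix x assume "x \<in> cube n"
    then have "c \<le> resample_max n x f"
      using resample_mean_le_max[of n n x f] resample_mean_length[of x f] by (simp add: c_def cube_def)
    then show "0 \<le> resample_max n x f" using c by simp
  qed auto
  also have "\<dots> \<le> 4 * (\<Sum>x\<in>cube n. (f x)\<^sup>2) - 4 * c * (\<Sum>x\<in>cube n. f x) + 2 * c\<^sup>2 * 2 ^ n"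
    using c by (intro sum_max_resample_max_le) auto
  also have "\<dots> \<le> 4 * (\<Sum>x\<in>cube n. (f x)\<^sup>2)"
    unfolding c using c(2) by (simp add: power2_eq_square algebra_simps)
  finally show ?thesis .
qed

text \<open>Terms with m < k vanish, and m = k + j turns the rest into
  \<open>gbinomial_sum_nat_pow2\<close>.\<close>

lemma sum_choose_div_power2: "(\<Sum>m\<le>2 * k. real (m choose k) / 2 ^ m) = 1"
proof -
  have "(\<Sum>m\<le>2 * k. real (m choose k) / 2 ^ m) = (\<Sum>m\<in>{k..2 * k}. real (m choose k) / 2 ^ m)"
    by (intro sum.mono_neutral_right) auto
  also have "\<dots> = (\<Sum>j\<le>k. real (k + j choose k) / 2 ^ (k + j))"
    by (rule sum.reindex_bij_witness[where i="\<lambda>j. k + j" and j="\<lambda>m. m - k"]) auto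
  also have "\<dots> = (\<Sum>j\<le>k. (of_nat (k + j) gchoose j) / 2 ^ j) / 2 ^ k"
    unfolding sum_divide_distrib
    by (intro sum.cong refl)
       (simp add: power_add binomial_gbinomial[symmetric] binomial_symmetric[of k "k + _"] del: of_nat_add)
  also have "\<dots> = 1" by (simp only: gbinomial_sum_nat_pow2) simp
  finally show ?thesis .
qed

text \<open>By \<open>sum_choose_div_power2\<close> the resampling means with m \<le> 2k give radius
  k total weight 1. Whatever else the right side contains is nonnegative.\<close>

lemma sum_sphere_means_le:
  assumes "\<And>x. 0 \<le> f x"
  shows "(\<Sum>k\<le>K. sphere_sum x k f / real (length x choose k)) \<le> (\<Sum>m\<le>2 * K. resample_mean m x f)"
proof -
  define S where "S k = sphere_sum x k f / real (length x choose k)" for k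
  have S: "0 \<le> S k" for k by (simp add: S_def sphere_sum_nonneg assms)
  have "(\<Sum>k\<le>K. S k) = (\<Sum>k\<le>K. \<Sum>m\<le>2 * k. real (m choose k) / 2 ^ m * S k)"
    by (simp only: sum_distrib_right[symmetric] sum_choose_div_power2 mult_1)
  also have "\<dots> \<le> (\<Sum>k\<le>K. \<Sum>m\<le>2 * K. real (m choose k) / 2 ^ m * S k)"
    by (intro sum_mono sum_mono2) (auto simp: S)
  also have "\<dots> = (\<Sum>m\<le>2 * K. \<Sum>k\<le>K. real (m choose k) / 2 ^ m * S k)"
    by (rule sum.swap)
  \<comment> \<open>The range up to \<open>max K m\<close> contains both k \<le> K and k \<le> m;
    beyond m the binomial coefficient is 0.\<close>
  also have "\<dots> \<le> (\<Sum>m\<le>2 * K. \<Sum>k\<le>max K m. real (m choose k) / 2 ^ m * S k)"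
    by (intro sum_mono sum_mono2) (auto simp: S)
  also have "\<dots> = (\<Sum>m\<le>2 * K. resample_mean m x f)"
    unfolding resample_mean_def S_def
    by (intro sum.cong refl sum.mono_neutral_right) auto
  finally show ?thesis by (simp add: S_def)
qed

section \<open>The square function and the maximal operator\<close>

lemma sph_mean_eq: "x \<in> cube n \<Longrightarrow> sph_mean n k f x = sphere_sum x k f / real (n choose k)"
  by (simp add: sph_mean_def sphere_sum_def cube_def)

lemma sph_mean_nonneg: "(\<And>y. 0 \<le> f y) \<Longrightarrow> 0 \<le> sph_mean n k f x"
  by (simp add: sph_mean_def sum_nonneg)

lemma abs_sph_mean_le: "\<bar>sph_mean n k f x\<bar> \<le> sph_mean n k (\<lambda>y. \<bar>f y\<bar>) x"
  by (simp add: sph_mean_def divide_right_mono)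

lemma fourier_sph_mean:
  assumes "length s = n"
  shows "fourier (sph_mean n k f) s = kap (weight s) (coweight s) k * fourier f s"
proof -
  have "fourier (sph_mean n k f) s = fourier (\<lambda>x. 1 / real (n choose k) * sphere_sum x k f) s"
    unfolding fourier_def using assms by (intro sum.cong) (auto simp: sph_mean_eq)
  also have "\<dots> = kap (weight s) (coweight s) k * fourier f s"
    unfolding fourier_cmult fourier_sphere_sum kap_def weight_add_coweight assms by simp
  finally show ?thesis .
qed

lemma sum_sph_mean_sq_le: "(\<Sum>x\<in>cube n. (sph_mean n k f x)\<^sup>2) \<le> (\<Sum>x\<in>cube n. (f x)\<^sup>2)"
proof -
  have "2 ^ n * (\<Sum>x\<in>cube n. (sph_mean n k f x)\<^sup>2)
      = (\<Sum>s\<in>cube n. (kap (weight s) (coweight s) k)\<^sup>2 * (fourier f s)\<^sup>2)"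
    unfolding parseval[symmetric]
    by (intro sum.cong) (auto simp: cube_def fourier_sph_mean power_mult_distrib)
  also have "\<dots> \<le> (\<Sum>s\<in>cube n. 1 * (fourier f s)\<^sup>2)"
    using abs_kap_le_1 by (intro sum_mono mult_right_mono) (auto simp: abs_square_le_1)
  also have "\<dots> = 2 ^ n * (\<Sum>x\<in>cube n. (f x)\<^sup>2)" by (simp add: parseval)
  finally show ?thesis by simp
qed

text \<open>The square of a discrete Littlewood-Paley function. Only even radii occur: at full
  weight the eigenvalue of radius k is (-1)^k, so consecutive radii would not cancel. The bound j <
  n div 4 keeps all radii at most n/2.\<close>

definition square_fun :: "nat \<Rightarrow> (bool list \<Rightarrow> real) \<Rightarrow> bool list \<Rightarrow> real" where
  "square_fun n f x =
     (\<Sum>j<n div 4. (real j + 1) * (sph_mean n (2 * j + 2) f x - sph_mean n (2 * j) f x)\<^sup>2)"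

lemma square_fun_nonneg: "0 \<le> square_fun n f x"
  by (simp add: square_fun_def sum_nonneg)

text \<open>By \<open>parseval\<close> the sum becomes a Fourier multiplier, which
  \<open>sum_kap_diff_le\<close> bounds by 256 uniformly in \<open>s\<close>.\<close>

lemma sum_square_fun_le: "(\<Sum>x\<in>cube n. square_fun n f x) \<le> 256 * (\<Sum>x\<in>cube n. (f x)\<^sup>2)"
proof -
  let ?D = "\<lambda>j x. sph_mean n (2 * j + 2) f x - sph_mean n (2 * j) f x"
  let ?d = "\<lambda>j s. kap (weight s) (coweight s) (2 * j + 2) - kap (weight s) (coweight s) (2 * j)"
  have fourier_D: "fourier (?D j) s = ?d j s * fourier f s" if "s \<in> cube n" for j s
  proof -
    have "fourier (?D j) s = fourier (sph_mean n (2 * j + 2) f) s - fourier (sph_mean n (2 * j) f) s"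
      by (simp add: fourier_def algebra_simps sum_subtractf)
    then show ?thesis using that by (simp add: fourier_sph_mean cube_def left_diff_distrib)
  qed
  have "2 ^ n * (\<Sum>x\<in>cube n. square_fun n f x)
      = (\<Sum>j<n div 4. (real j + 1) * (2 ^ n * (\<Sum>x\<in>cube n. (?D j x)\<^sup>2)))"
    unfolding square_fun_def
    by (simp only: sum_distrib_left mult.left_commute) (rule sum.swap)
  also have "\<dots> = (\<Sum>j<n div 4. (real j + 1) * (\<Sum>s\<in>cube n. (?d j s)\<^sup>2 * (fourier f s)\<^sup>2))"
    unfolding parseval[symmetric]
    by (intro sum.cong refl arg_cong2[where f="(*)"]) (simp only: fourier_D power_mult_distrib)
  also have "\<dots> = (\<Sum>s\<in>cube n. (\<Sum>j<n div 4. (real j + 1) * (?d j s)\<^sup>2) * (fourier f s)\<^sup>2)"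
    unfolding sum_distrib_left sum_distrib_right mult.assoc by (rule sum.swap)
  also have "\<dots> \<le> (\<Sum>s\<in>cube n. 256 * (fourier f s)\<^sup>2)"
  proof (intro sum_mono mult_right_mono)
    fix s assume "s \<in> cube n"
    then have "4 * (n div 4) \<le> weight s + coweight s"
      by (simp only: weight_add_coweight) (simp add: cube_def)
    then show "(\<Sum>j<n div 4. (real j + 1) * (?d j s)\<^sup>2) \<le> 256"
      by (rule sum_kap_diff_le)
  qed simp
  also have "\<dots> = 2 ^ n * (256 * (\<Sum>x\<in>cube n. (f x)\<^sup>2))"
    by (simp add: parseval flip: sum_distrib_left)
  finally show ?thesis by simp
qed

section \<open>Majorants for even and odd radii\<close>

lemma abel_sum:
  fixes a :: "nat \<Rightarrow> real"
  shows "(real J + 1) * a J = (\<Sum>j\<le>J. a j) + (\<Sum>j<J. (real j + 1) * (a (Suc j) - a j))"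
  by (induction J) (simp_all add: algebra_simps)

text \<open>Cauchy-Schwarz with the weight j + 1 split evenly between the two factors; the weights
  sum to at most (J + 1)^2. The resulting J + 1 matches the left side of
  \<open>abel_sum\<close>.\<close>

lemma sum_weighted_le:
  fixes d :: "nat \<Rightarrow> real"
  shows "(\<Sum>j<J. (real j + 1) * d j) \<le> (real J + 1) * sqrt (\<Sum>j<J. (real j + 1) * (d j)\<^sup>2)"
proof -
  let ?Q = "\<Sum>j<J. (real j + 1) * (d j)\<^sup>2"
  have Q: "0 \<le> ?Q" by (simp add: sum_nonneg)
  have "(\<Sum>j<J. (real j + 1) * d j)\<^sup>2 = (\<Sum>j<J. sqrt (real j + 1) * (sqrt (real j + 1) * d j))\<^sup>2"
    by (simp flip: mult.assoc)
  also have "\<dots> \<le> (\<Sum>j<J. (sqrt (real j + 1))\<^sup>2) * (\<Sum>j<J. (sqrt (real j + 1) * d j)\<^sup>2)"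
    by (rule Cauchy_Schwarz_ineq_sum)
  also have "\<dots> = (\<Sum>j<J. real j + 1) * ?Q"
    by (simp add: power_mult_distrib)
  also have "(\<Sum>j<J. real j + 1) \<le> (\<Sum>j<J. real J + 1)"
    by (intro sum_mono) auto
  then have "(\<Sum>j<J. real j + 1) * ?Q \<le> (real J + 1)\<^sup>2 * ?Q"
    using Q by (intro mult_right_mono) (auto simp: power2_eq_square algebra_simps)
  finally have "(\<Sum>j<J. (real j + 1) * d j)\<^sup>2 \<le> ((real J + 1) * sqrt ?Q)\<^sup>2"
    using Q by (simp add: power_mult_distrib)
  then show ?thesis by (rule power2_le_imp_le) (simp add: Q)
qed

definition even_majorant :: "nat \<Rightarrow> (bool list \<Rightarrow> real) \<Rightarrow> bool list \<Rightarrow> real" where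
  "even_majorant n f x = 4 * resample_max n x f + sqrt (square_fun n f x)"

text \<open>\<open>abel_sum\<close> splits J + 1 copies of the mean into a plain sum, controlled by
  the resampling means, and weighted differences, controlled by
  \<open>sum_weighted_le\<close>.\<close>

lemma sph_mean_even_le:
  assumes f: "\<And>y. 0 \<le> f y" and x: "x \<in> cube n" and J: "4 * J \<le> n"
  shows "sph_mean n (2 * J) f x \<le> even_majorant n f x"
proof -
  define a where "a j = sph_mean n (2 * j) f x" for j
  let ?M = "resample_max n x f"
  have "f x = resample_mean 0 x f" by (simp add: resample_mean_def)
  then have M: "0 \<le> ?M" using f[of x] resample_mean_le_max[of 0 n x f] by simp
  have "(\<Sum>j\<le>J. a j) = (\<Sum>k\<in>(\<lambda>j. 2 * j) ` {..J}. sph_mean n k f x)"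
    by (simp add: a_def sum.reindex inj_on_def)
  also have "\<dots> \<le> (\<Sum>k\<le>2 * J. sph_mean n k f x)"
    using f by (intro sum_mono2) (auto intro: sph_mean_nonneg)
  also have "\<dots> \<le> (\<Sum>m\<le>2 * (2 * J). resample_mean m x f)"
    using sum_sphere_means_le[of f x "2 * J"] f x by (simp add: sph_mean_eq cube_def)
  also have "\<dots> \<le> (\<Sum>m\<le>2 * (2 * J). ?M)"
    using J by (intro sum_mono resample_mean_le_max) auto
  \<comment> \<open>There are 4J + 1 \<le> 4 (J + 1) summands, which gives the 4 in
    \<open>even_majorant\<close>.\<close>
  also have "\<dots> \<le> (real J + 1) * (4 * ?M)"
    using M by (simp add: algebra_simps)
  finally have 1: "(\<Sum>j\<le>J. a j) \<le> (real J + 1) * (4 * ?M)" .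
  have "(\<Sum>j<J. (real j + 1) * (a (Suc j) - a j))
     \<le> (real J + 1) * sqrt (\<Sum>j<J. (real j + 1) * (a (Suc j) - a j)\<^sup>2)"
    by (rule sum_weighted_le)
  also have "\<dots> \<le> (real J + 1) * sqrt (square_fun n f x)"
    unfolding square_fun_def a_def using J
    by (intro mult_left_mono real_sqrt_le_mono) (auto intro!: sum_mono2)
  finally have "(real J + 1) * a J \<le> (real J + 1) * even_majorant n f x"
    using 1 unfolding abel_sum[of J a] even_majorant_def by (simp add: algebra_simps)
  then show ?thesis by (simp add: a_def)
qed

lemma even_majorant_nonneg:
  assumes "\<And>y. 0 \<le> f y" "x \<in> cube n"
  shows "0 \<le> even_majorant n f x"
proof -
  have "0 \<le> sph_mean n (2 * 0) f x" using assms(1) by (rule sph_mean_nonneg)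
  also have "\<dots> \<le> even_majorant n f x" using assms by (rule sph_mean_even_le) simp
  finally show ?thesis .
qed

text \<open>From (4p + q)^2 \<le> 32 p^2 + 2 q^2 and the bounds 4 and 256 comes 32 * 4 + 2 * 256 =
  640.\<close>

lemma sum_even_majorant_le:
  assumes "\<And>y. 0 \<le> f y"
  shows "(\<Sum>x\<in>cube n. (even_majorant n f x)\<^sup>2) \<le> 640 * (\<Sum>x\<in>cube n. (f x)\<^sup>2)"
proof -
  have "(even_majorant n f x)\<^sup>2 \<le> 32 * (resample_max n x f)\<^sup>2 + 2 * square_fun n f x" for x
  proof -
    have "(4 * p + q)\<^sup>2 \<le> 32 * p\<^sup>2 + 2 * q\<^sup>2" for p q :: real
      using zero_le_power2[of "4 * p - q"] by (simp add: power2_eq_square algebra_simps)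
    from this[of "resample_max n x f" "sqrt (square_fun n f x)"] show ?thesis
      by (simp add: even_majorant_def square_fun_nonneg)
  qed
  then have "(\<Sum>x\<in>cube n. (even_majorant n f x)\<^sup>2)
      \<le> 32 * (\<Sum>x\<in>cube n. (resample_max n x f)\<^sup>2) + 2 * (\<Sum>x\<in>cube n. square_fun n f x)"
    by (simp only: sum_distrib_left sum.distrib[symmetric]) (intro sum_mono)
  then show ?thesis
    using sum_resample_max_le[of f n, OF assms] sum_square_fun_le[of n f] by linarith
qed

text \<open>Normalizing \<open>sphere_sum_Suc_le\<close> leaves the factor n/(n - j), at most 2 for
  j \<le> n/2.\<close>

lemma sph_mean_Suc_le:
  assumes f: "\<And>y. 0 \<le> f y" and x: "x \<in> cube n" and j: "2 * j \<le> n" "j < n"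
  shows "sph_mean n (Suc j) f x \<le> 2 * sph_mean n j (sph_mean n 1 f) x"
proof -
  have len: "length x = n" using x by (simp add: cube_def)
  have c: "(real j + 1) * real (n choose Suc j) = (real n - real j) * real (n choose j)"
    using j by (intro choose_real_up) simp
  have pos: "0 < real (n choose Suc j)" "0 < real (n choose j)" using j by auto
  have "(real j + 1) * sphere_sum x (Suc j) f \<le> sphere_sum x j (\<lambda>y. sphere_sum y 1 f)"
    using sphere_sum_Suc_le[of f j x] f by (simp add: add.commute)
  also have "\<dots> = real n * sphere_sum x j (\<lambda>y. sphere_sum y 1 f / real n)"
    using j by (simp add: sphere_sum_divide)
  also have "sphere_sum x j (\<lambda>y. sphere_sum y 1 f / real n) = sphere_sum x j (sph_mean n 1 f)"
    by (rule sphere_sum_cong) (simp add: sph_mean_eq len)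
  also have "real n * \<dots> \<le> 2 * (real n - real j) * sphere_sum x j (sph_mean n 1 f)"
    using j f by (intro mult_right_mono sphere_sum_nonneg sph_mean_nonneg) auto
  finally have "(real j + 1) * sphere_sum x (Suc j) f / ((real j + 1) * real (n choose Suc j))
      \<le> 2 * (real n - real j) * sphere_sum x j (sph_mean n 1 f) / ((real n - real j) * real (n choose j))"
    unfolding c using j by (intro divide_right_mono) auto
  moreover have "(real j + 1) * sphere_sum x (Suc j) f / ((real j + 1) * real (n choose Suc j))
      = sph_mean n (Suc j) f x"
    unfolding sph_mean_eq[OF x] by (rule mult_divide_mult_cancel_left) simp
  moreover have "2 * (real n - real j) * sphere_sum x j (sph_mean n 1 f) / ((real n - real j) * real (n choose j))
      = 2 * sph_mean n j (sph_mean n 1 f) x"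
  proof -
    have "2 * p * q / (p * c) = 2 * (q / c)" if "p \<noteq> 0" for p q c :: real
      using that by simp
    moreover have "real n - real j \<noteq> 0" using j by simp
    ultimately show ?thesis unfolding sph_mean_eq[OF x] by blast
  qed
  ultimately show ?thesis by simp
qed

text \<open>\<open>map Not x\<close> is the antipode of \<open>x\<close>; this folds radii above n/2
  onto radii below it.\<close>

lemma sph_mean_map_Not:
  assumes "x \<in> cube n" "k \<le> n"
  shows "sph_mean n k f x = sph_mean n (n - k) f (map Not x)"
proof -
  have "sphere_sum (map Not x) (n - k) f = sphere_sum x k f"
    using sphere_sum_map_Not[of "n - k" x f] assms by (simp add: cube_def)
  moreover have "map Not x \<in> cube n" using assms by (simp add: cube_def)
  ultimately show ?thesis using assms by (simp add: sph_mean_eq binomial_symmetric[of k n])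
qed

lemma sph_mean_half_le:
  assumes f: "\<And>y. 0 \<le> f y" and x: "x \<in> cube n" and k: "2 * k \<le> n" and n: "1 \<le> n"
  shows "sph_mean n k f x \<le> even_majorant n f x + 2 * even_majorant n (sph_mean n 1 f) x"
proof -
  have g: "\<And>y. 0 \<le> sph_mean n 1 f y" using f by (rule sph_mean_nonneg)
  note nn = even_majorant_nonneg[of f, OF f x] even_majorant_nonneg[of "sph_mean n 1 f", OF g x]
  show ?thesis
  proof (cases "even k")
    case True
    then obtain J where "k = 2 * J" by blast
    then show ?thesis using sph_mean_even_le[of f, OF f x, of J] nn k by simp
  next
    case False
    then obtain J where J: "k = Suc (2 * J)" by (auto elim: oddE)
    have "sph_mean n k f x \<le> 2 * sph_mean n (2 * J) (sph_mean n 1 f) x"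
      unfolding J using k J by (intro sph_mean_Suc_le[of f, OF f x]) auto
    also have "\<dots> \<le> 2 * even_majorant n (sph_mean n 1 f) x"
      using sph_mean_even_le[of "sph_mean n 1 f", OF g x, of J] k J by simp
    finally show ?thesis using nn by simp
  qed
qed

theorem theorem1:
  shows "\<exists>A::real. \<forall>n::nat. n \<ge> 1 \<longrightarrow>
           (\<forall>f :: bool list \<Rightarrow> real. l2norm n (sph_max n f) \<le> A * l2norm n f)"
proof (intro exI[of _ 160] allI impI)
  fix n :: nat and f :: "bool list \<Rightarrow> real"
  assume n: "n \<ge> 1"
  \<comment> \<open>The positivity arguments are applied to |f|, which dominates by
    \<open>abs_sph_mean_le\<close>.\<close>
  define h where "h = (\<lambda>y. \<bar>f y\<bar>)"
  define g where "g = sph_mean n 1 h"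
  have h: "\<And>y. 0 \<le> h y" by (simp add: h_def)
  have g: "\<And>y. 0 \<le> g y" unfolding g_def using h by (rule sph_mean_nonneg)
  define E where "E x = even_majorant n h x + 2 * even_majorant n g x" for x
  have E_nonneg: "0 \<le> E x" if "x \<in> cube n" for x
    using even_majorant_nonneg[of h, OF h that] even_majorant_nonneg[of g, OF g that] by (simp add: E_def)
  let ?H = "\<Sum>x\<in>cube n. (f x)\<^sup>2"
  have "(E x)\<^sup>2 \<le> 2 * (even_majorant n h x)\<^sup>2 + 8 * (even_majorant n g x)\<^sup>2" for x
  proof -
    have "(p + 2 * q)\<^sup>2 \<le> 2 * p\<^sup>2 + 8 * q\<^sup>2" for p q :: real
      using zero_le_power2[of "p - 2 * q"] by (simp add: power2_eq_square algebra_simps)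
    then show ?thesis by (simp add: E_def)
  qed
  then have "(\<Sum>x\<in>cube n. (E x)\<^sup>2)
      \<le> 2 * (\<Sum>x\<in>cube n. (even_majorant n h x)\<^sup>2) + 8 * (\<Sum>x\<in>cube n. (even_majorant n g x)\<^sup>2)"
    by (simp only: sum_distrib_left sum.distrib[symmetric]) (intro sum_mono)
  also have "\<dots> \<le> 2 * (640 * ?H) + 8 * (640 * ?H)"
    using sum_even_majorant_le[of h n, OF h] sum_even_majorant_le[of g n, OF g]
      sum_sph_mean_sq_le[of n 1 h] by (simp add: g_def h_def)
  finally have E_sum: "(\<Sum>x\<in>cube n. (E x)\<^sup>2) \<le> 6400 * ?H" by simp
  have point: "(sph_max n f x)\<^sup>2 \<le> 2 * (E x)\<^sup>2 + 2 * (E (map Not x))\<^sup>2" if x: "x \<in> cube n" for x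
  proof -
    have x': "map Not x \<in> cube n" using x by (simp add: cube_def)
    have "sph_max n f x \<in> (\<lambda>k. sph_mean n k f x) ` {0..n}"
      unfolding sph_max_def by (rule Max_in) auto
    then obtain k where k: "k \<le> n" "sph_max n f x = sph_mean n k f x" by auto
    have "\<bar>sph_max n f x\<bar> \<le> sph_mean n k h x"
      using abs_sph_mean_le[of n k f x] k by (simp add: h_def)
    \<comment> \<open>Radii up to n/2 are bounded by \<open>E x\<close>, larger ones by
      \<open>E\<close> at the antipode; the sum covers both.\<close>
    also have "\<dots> \<le> E x + E (map Not x)"
    proof (cases "2 * k \<le> n")
      case True
      then show ?thesis
        using sph_mean_half_le[of h, OF h x True n] E_nonneg[OF x'] by (simp add: E_def g_def)
    next
      case False
      then have "2 * (n - k) \<le> n" by simp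
      from sph_mean_half_le[of h, OF h x' this n] show ?thesis
        using E_nonneg[OF x] k by (simp add: E_def g_def sph_mean_map_Not[OF x k(1)])
    qed
    finally have "\<bar>sph_max n f x\<bar>\<^sup>2 \<le> (E x + E (map Not x))\<^sup>2"
      by (rule power_mono) simp
    moreover have "(p + q)\<^sup>2 \<le> 2 * p\<^sup>2 + 2 * q\<^sup>2" for p q :: real
      using zero_le_power2[of "p - q"] by (simp add: power2_eq_square algebra_simps)
    ultimately show ?thesis by (metis order_trans power2_abs)
  qed
  have "(\<Sum>x\<in>cube n. (sph_max n f x)\<^sup>2)
      \<le> 2 * (\<Sum>x\<in>cube n. (E x)\<^sup>2) + 2 * (\<Sum>x\<in>cube n. (E (map Not x))\<^sup>2)"
    using point by (simp only: sum_distrib_left sum.distrib[symmetric]) (intro sum_mono)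
  also have "(\<Sum>x\<in>cube n. (E (map Not x))\<^sup>2) = (\<Sum>x\<in>cube n. (E x)\<^sup>2)"
    by (rule sum_cube_map_Not)
  \<comment> \<open>Here 6400 = (2 + 8) * 640, and 4 * 6400 = 160^2 fixes the constant.\<close>
  also have "2 * (\<Sum>x\<in>cube n. (E x)\<^sup>2) + 2 * (\<Sum>x\<in>cube n. (E x)\<^sup>2) \<le> 160\<^sup>2 * ?H"
    using E_sum by simp
  finally have "l2norm n (sph_max n f) \<le> sqrt (160\<^sup>2 * ?H)"
    unfolding l2norm_def by (rule real_sqrt_le_mono)
  then show "l2norm n (sph_max n f) \<le> 160 * l2norm n f"
    by (simp only: l2norm_def real_sqrt_mult real_sqrt_abs abs_numeral)
qed

end
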